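(* Let the smoothness parameters $\alpha>\frac12$, $\beta\le0$, $\gamma\ge0$ with $\alpha+\beta>\max\{\gamma,\frac12\}$, the dimension $d\in\mathbb{N}$, $d\ge2$, and the refinement $R\ge1$ be given. Assume that $\Lambda(\boldsymbol z,M)$ is a reconstructing rank-1 lattice for $H_R^{d,0}$ constructed by the CBC strategy. Then $$M^{-(\alpha+\beta-\gamma)/2}\lesssim\big\|\mathrm{Id}-S_{H_R^{d,0}}^{\Lambda(\boldsymbol z,M)}\big|\mathcal{H}^{\alpha,\beta}(\mathbb{T}^d)\to\mathcal{H}^{\gamma}(\mathbb{T}^d)\big\|\lesssim 2^{-(\alpha+\beta-\gamma)R}\begin{cases}R^{(d-1)/2}&:\ \beta=0,\\1&:\ \beta<0\end{cases}$$ $$\lesssim M^{-(\alpha+\beta-\gamma)/2}(\log M)^{(d-2)(\alpha+\beta-\gamma)/2}\begin{cases}(\log M)^{(d-1)/2}&:\ \beta=0,\\1&:\ \beta<0.\end{cases}$$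
   Context: $\mathbb{T}=[0,1)$ is the torus, $\hat f_{\boldsymbol k}=\int_{\mathbb{T}^d}f(\boldsymbol x)e^{-2\pi i\boldsymbol k\cdot\boldsymbol x}\,d\boldsymbol x$. For real $\alpha,\beta$, $\mathcal{H}^{\alpha,\beta}(\mathbb{T}^d)$ is the space of $f\in L_2(\mathbb{T}^d)$ with finite norm $$\|f|\mathcal{H}^{\alpha,\beta}(\mathbb{T}^d)\|^2=\sum_{\boldsymbol k\in\mathbb{Z}^d}|\hat f_{\boldsymbol k}|^2(1+\|\boldsymbol k\|_2^2)^{\beta}\prod_{s=1}^d(1+|k_s|^2)^{\alpha},$$ and $\mathcal{H}^{\gamma}(\mathbb{T}^d):=\mathcal{H}^{0,\gamma}(\mathbb{T}^d)$. Under the hypotheses elements of $\mathcal{H}^{\alpha,\beta}(\mathbb{T}^d)$ are continuous (after choosing the continuous representative). Hyperbolic cross: $Q_0=\{-1,0,1\}$, $Q_j=([-2^j,-2^{j-1}-1]\cup[2^{j-1}+1,2^j])\cap\mathbb{Z}$ for $j\ge1$, $Q_{\boldsymbol j}=Q_{j_1}\times\dots\times Q_{j_d}$, $J_R^{d,0}=\{\boldsymbol j\in\mathbb{N}_0^d:\|\boldsymbol j\|_1\le R+d-1\}$, $H_R^{d,0}=\bigcup_{\boldsymbol j\in J_R^{d,0}}Q_{\boldsymbol j}$. For $\boldsymbol z\in\mathbb{Z}^d$, $M\in\mathbb{N}$, the rank-1 lattice with generating vector $\boldsymbol z$ and size $M$ is $\Lambda(\boldsymbol z,M)=\{\frac jM\boldsymbol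 z\bmod\boldsymbol 1:j=0,\dots,M-1\}$. For finite $I\subset\mathbb{Z}^d$ the sampling operator is $$S_I^{\Lambda(\boldsymbol z,M)}f=\sum_{\boldsymbol k\in I}\hat f_{\boldsymbol k}^{\Lambda(\boldsymbol z,M)}e^{2\pi i\boldsymbol k\cdot\circ},\qquad \hat f_{\boldsymbol k}^{\Lambda(\boldsymbol z,M)}=\frac1M\sum_{j=0}^{M-1}f\big(\tfrac jM\boldsymbol z\big)e^{-2\pi i\frac jM\boldsymbol k\cdot\boldsymbol z}.$$ $\Lambda(\boldsymbol z,M)$ is a reconstructing rank-1 lattice for $I$ if $S_I^{\Lambda(\boldsymbol z,M)}p=p$ for all trigonometric polynomials $p$ with frequencies in $I$; equivalently $\boldsymbol k^1\cdot\boldsymbol z\not\equiv\boldsymbol k^2\cdot\boldsymbol z\pmod M$ for all distinct $\boldsymbol k^1,\boldsymbol k^2\in I$. The CBC (component-by-component) strategy is the search algorithm of Table 3.1 in L. Kämmerer's dissertation: it constructs the generating vector $\boldsymbol z$ of a reconstructing rank-1 lattice component by component, iteratively increasing the dimension of the index set for which the reconstruction property should hold. With it one can explicitly construct reconstructing rank-1 lattices for $H_R^{d,0}$ of size $2^{2R-2}\le M\lesssim 2^{2R}R^{d-2}$. $\|A|X\to Y\|$ is the operator norm; $a\lesssim b$ means $a\le c\,b$ with a constant $c>0$ independent of $R,\boldsymbol z,M$. *)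

theory Defs
  imports "HOL-Analysis.Analysis"
begin

text \<open>
  The dimension is \<open>d = CARD('n)\<close>.  Functions on the torus are functions on \<open>real ^ 'n\<close> that are
  1-periodic in every coordinate; integrals are taken over the fundamental domain \<open>[0,1)\<close> in each
  coordinate.
\<close>

definition torus :: "(real ^ 'n::finite) set" where
  "torus = {x. \<forall>s. x $ s \<in> {0..<1}}"

definition periodic :: "(real ^ 'n::finite \<Rightarrow> complex) \<Rightarrow> bool" where
  "periodic f \<longleftrightarrow> (\<forall>x s. f (x + axis s 1) = f x)"

definition L2_torus :: "(real ^ 'n::finite \<Rightarrow> complex) set" where
  "L2_torus = {f. periodic f \<and> f \<in> borel_measurable lebesgue \<and>
                  set_integrable lebesgue torus (\<lambda>x. (cmod (f x))\<^sup>2)}"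

definition freq_dot :: "int ^ 'n::finite \<Rightarrow> real ^ 'n \<Rightarrow> real" where
  "freq_dot k x = (\<Sum>s\<in>UNIV. of_int (k $ s) * x $ s)"

definition fourier_exp :: "int ^ 'n::finite \<Rightarrow> real ^ 'n \<Rightarrow> complex" where
  "fourier_exp k x = exp (2 * of_real pi * \<i> * of_real (freq_dot k x))"

definition fourier_coeff :: "(real ^ 'n::finite \<Rightarrow> complex) \<Rightarrow> int ^ 'n \<Rightarrow> complex" where
  "fourier_coeff f k = (LINT x:torus|lebesgue. f x * fourier_exp (- k) x)"


subsection \<open>Spaces of hybrid mixed smoothness\<close>

definition hybrid_weight :: "real \<Rightarrow> real \<Rightarrow> int ^ 'n::finite \<Rightarrow> real" where
  "hybrid_weight \<alpha> \<beta> k =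
     (1 + (\<Sum>s\<in>UNIV. (of_int (k $ s))\<^sup>2)) powr \<beta> * (\<Prod>s\<in>UNIV. (1 + (of_int (k $ s))\<^sup>2) powr \<alpha>)"

definition hybrid_space :: "real \<Rightarrow> real \<Rightarrow> (real ^ 'n::finite \<Rightarrow> complex) set" where
  "hybrid_space \<alpha> \<beta> = {f \<in> L2_torus.
     (\<lambda>k. (cmod (fourier_coeff f k))\<^sup>2 * hybrid_weight \<alpha> \<beta> k) summable_on UNIV}"

text \<open>The norm is extended by infinity to functions outside the space.\<close>

definition hybrid_norm :: "real \<Rightarrow> real \<Rightarrow> (real ^ 'n::finite \<Rightarrow> complex) \<Rightarrow> ennreal" where
  "hybrid_norm \<alpha> \<beta> f =
     (if f \<in> hybrid_space \<alpha> \<beta>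
      then ennreal (sqrt (\<Sum>\<^sub>\<infinity>k. (cmod (fourier_coeff f k))\<^sup>2 * hybrid_weight \<alpha> \<beta> k))
      else \<infinity>)"

text \<open>
  Elements of the hybrid space are equivalence classes; point evaluation is defined through the
  continuous representative.  This set consists of exactly these representatives.
\<close>

definition cont_hybrid_space :: "real \<Rightarrow> real \<Rightarrow> (real ^ 'n::finite \<Rightarrow> complex) set" where
  "cont_hybrid_space \<alpha> \<beta> = {f \<in> hybrid_space \<alpha> \<beta>. continuous_on UNIV f}"

definition sobolev_norm :: "real \<Rightarrow> (real ^ 'n::finite \<Rightarrow> complex) \<Rightarrow> ennreal" where
  "sobolev_norm \<gamma> = hybrid_norm 0 \<gamma>"

text \<open>The value is infinity for an unbounded operator.\<close>

definition operator_norm ::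
  "'a set \<Rightarrow> ('a \<Rightarrow> ennreal) \<Rightarrow> ('b \<Rightarrow> ennreal) \<Rightarrow> ('a \<Rightarrow> 'b) \<Rightarrow> ennreal" where
  "operator_norm X norm_X norm_Y T = (SUP f\<in>{f \<in> X. norm_X f \<le> 1}. norm_Y (T f))"


subsection \<open>Hyperbolic crosses\<close>

definition dyadic_block :: "nat \<Rightarrow> int set" where
  "dyadic_block j =
     (if j = 0 then {-1, 0, 1}
      else {- (2 ^ j) .. - (2 ^ (j - 1)) - 1} \<union> {2 ^ (j - 1) + 1 .. 2 ^ j})"

definition cross_levels :: "real \<Rightarrow> (nat ^ 'n::finite) set" where
  "cross_levels R = {j. real (\<Sum>s\<in>UNIV. j $ s) \<le> R + real CARD('n) - 1}"

definition hyperbolic_cross :: "real \<Rightarrow> (int ^ 'n::finite) set" where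
  "hyperbolic_cross R = (\<Union>j\<in>cross_levels R. {k. \<forall>s. k $ s \<in> dyadic_block (j $ s)})"


subsection \<open>Sampling along rank-1 lattices\<close>

definition lattice_node :: "int ^ 'n::finite \<Rightarrow> nat \<Rightarrow> nat \<Rightarrow> real ^ 'n" where
  "lattice_node z M j = (\<chi> s. real j / real M * of_int (z $ s))"

definition lattice_coeff ::
  "int ^ 'n::finite \<Rightarrow> nat \<Rightarrow> (real ^ 'n \<Rightarrow> complex) \<Rightarrow> int ^ 'n \<Rightarrow> complex" where
  "lattice_coeff z M f k =
     1 / of_nat M * (\<Sum>j<M. f (lattice_node z M j) * fourier_exp (- k) (lattice_node z M j))"

definition sampling_op ::
  "(int ^ 'n::finite) set \<Rightarrow> int ^ 'n \<Rightarrow> nat \<Rightarrow> (real ^ 'n \<Rightarrow> complex) \<Rightarrow> (real ^ 'n \<Rightarrow> complex)" where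
  "sampling_op I z M f = (\<lambda>x. \<Sum>k\<in>I. lattice_coeff z M f k * fourier_exp k x)"

definition trig_polys :: "(int ^ 'n::finite) set \<Rightarrow> (real ^ 'n \<Rightarrow> complex) set" where
  "trig_polys I = {p. \<exists>c. p = (\<lambda>x. \<Sum>k\<in>I. c k * fourier_exp k x)}"

definition reconstructing_lattice ::
  "(int ^ 'n::finite) set \<Rightarrow> int ^ 'n \<Rightarrow> nat \<Rightarrow> bool" where
  "reconstructing_lattice I z M \<longleftrightarrow> M \<ge> 1 \<and> (\<forall>p\<in>trig_polys I. sampling_op I z M p = p)"

text \<open>
  The projection of an index set onto the components up to \<open>s\<close>, embedded by filling up
  with zeros.  For such frequencies the components of the generating vector after \<open>s\<close> play no role,
  so the lattice is reconstructing for \<open>index_projection s I\<close> iff its truncation to the components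
  up to \<open>s\<close> is reconstructing for the lower-dimensional projected index set.
\<close>

definition index_projection ::
  "'n::{finite,linorder} \<Rightarrow> (int ^ 'n::{finite,linorder}) set \<Rightarrow> (int ^ 'n::{finite,linorder}) set" where
  "index_projection s I = (\<lambda>k. \<chi> t. if t \<le> s then k $ t else 0) ` I"

text \<open>
  The possible outputs of the component-by-component search for lattice size \<open>M\<close>: the components
  of \<open>z\<close> are chosen successively, and the choice of the component \<open>s\<close> must make the lattice generated
  by the components up to \<open>s\<close> reconstructing for the projected index set.  The search is
  nondeterministic, and \<open>z\<close> is not normalised modulo \<open>M\<close>.
\<close>

definition cbc_lattice ::
  "(int ^ 'n::{finite,linorder}) set \<Rightarrow> int ^ 'n::{finite,linorder} \<Rightarrow> nat \<Rightarrow> bool" where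
  "cbc_lattice I z M \<longleftrightarrow> (\<forall>s. reconstructing_lattice (index_projection s I) z M)"

end

(*
  The error f - Sf splits into the projection error on frequencies outside the cross and, for each k in
  the cross, the sum of the Fourier coefficients of f over the other elements of the coset of k modulo
  the dual lattice.  These cosets are disjoint, so by the Cauchy-Schwarz inequality it suffices to bound
  the sum of the reciprocal weights over a single punctured coset.  Reconstruction implies that a coset
  meets every box with side lengths 2^(i_s), where |i| = floor R + d - 1, at most once, hence it has
  O(2^(|j| - R)) points in a dyadic block of level j, and the weights sum up as geometric series.

  For the lower bound, the pigeonhole principle on the (floor (sqrt M) + 1)^2 frequencies of a square in a
  coordinate plane gives two that alias.  Rearranging their congruence yields two distinct aliasing
  frequencies of size at most sqrt M, one on each axis.  The difference of their exponentials vanishes on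
  the lattice, so the sampling operator maps it to 0.
*)

theory Submission
  imports Defs "HOL-Real_Asymp.Real_Asymp"
begin

section \<open>Fourier analysis on the torus\<close>

text \<open>Aliasing concerns point values, so \<open>f\<close> must equal its Fourier series at
  every node. The condition \<alpha> + \<beta> > 1/2 makes the reciprocal weights summable and hence
  the coefficients absolutely summable; uniqueness of Fourier coefficients, which rests on
  Stone-Weierstrass, then identifies the continuous representative with its series. The same
  condition governs the coset sums. Up to constants, a level vector of total n carries at most 2^(n
  - m) points, m being the radius of the cross, with reciprocal weights of order at most
  4^(-(\<alpha> + \<beta>) n), so the ratio is 2 * 4^(-(\<alpha> + \<beta>)) < 1. For \<beta> = 0
  all level vectors of total n count alike, and there are about n^(d - 1) of them; this is the power
  of R. For \<beta> < 0 the isotropic factor favours levels concentrated in one coordinate, and the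
  others sum geometrically. The last estimate is arithmetic: the upper bound on M trades 2^R for
  sqrt M at the cost of a power of R, and a crude lower bound 2^R \<le> M turns R into log
  M.\<close>

lemma torus_sets [measurable]: "(torus :: (real^'n::finite) set) \<in> sets borel"
proof -
  have "torus = (\<Inter>s. {x::real^'n. 0 \<le> x $ s} \<inter> {x. x $ s < 1})"
    by (auto simp: torus_def)
  moreover have "{x::real^'n. 0 \<le> x $ s} \<inter> {x. x $ s < 1} \<in> sets borel" for s
    by (intro sets.Int borel_closed borel_open closed_Collect_le open_Collect_less continuous_intros)
  then have "(\<Inter>s. {x::real^'n. 0 \<le> x $ s} \<inter> {x. x $ s < 1}) \<in> sets borel"
    by (intro sets.finite_INT) auto
  ultimately show ?thesis by (rule ssubst)
qed

lemma torus_subset_cbox: "torus \<subseteq> cbox 0 (1 :: real^'n::finite)"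
  by (auto simp: torus_def mem_box_cart less_imp_le)

lemma continuous_integrable_torus:
  fixes f :: "real^'n::finite \<Rightarrow> 'b::{banach, second_countable_topology}"
  assumes "continuous_on UNIV f"
  shows "set_integrable lebesgue torus f" "set_integrable lborel torus f"
proof -
  have "set_integrable lborel (cbox 0 1) f"
    unfolding set_integrable_def
    by (rule borel_integrable_compact) (auto intro: continuous_on_subset[OF assms])
  then show *: "set_integrable lborel torus f"
    by (rule set_integrable_subset) (use torus_sets torus_subset_cbox in auto)
  have [measurable]: "f \<in> borel_measurable borel"
    by (rule borel_measurable_continuous_onI[OF assms])
  have "(\<lambda>x. indicat_real torus x *\<^sub>R f x) \<in> borel_measurable lborel"
    by measurable
  with * show "set_integrable lebesgue torus f"
    by (simp add: set_integrable_def integrable_completion)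
qed

lemma set_integral_lebesgue_eq_lborel:
  fixes f :: "real^'n::finite \<Rightarrow> 'b::{banach, second_countable_topology}"
  assumes "continuous_on UNIV f"
  shows "(LINT x:torus|lebesgue. f x) = (LINT x:torus|lborel. f x)"
proof -
  have [measurable]: "f \<in> borel_measurable borel"
    by (rule borel_measurable_continuous_onI[OF assms])
  have "(\<lambda>x. indicat_real torus x *\<^sub>R f x) \<in> borel_measurable lborel"
    by measurable
  then show ?thesis
    by (simp add: set_lebesgue_integral_def integral_completion)
qed

text \<open>Lebesgue measure is the image of a product measure under the expansion in basis vectors,
  so Fubini for product measures factors the integral.\<close>

lemma integral_lborel_prod:
  fixes f :: "'a::euclidean_space \<Rightarrow> real \<Rightarrow> complex"
  assumes "\<And>b. b \<in> Basis \<Longrightarrow> integrable lborel (f b)"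
  shows "(\<integral>x. (\<Prod>b\<in>Basis. f b (x \<bullet> b)) \<partial>lborel) = (\<Prod>b\<in>Basis. integral\<^sup>L lborel (f b))"
proof -
  interpret product_sigma_finite "\<lambda>_::'a. lborel :: real measure"
    by standard
  have [measurable]: "f b \<in> borel_measurable borel" if "b \<in> Basis" for b
    using borel_measurable_integrable[OF assms[OF that]] by simp
  have eq: "(\<Sum>c\<in>Basis. y c *\<^sub>R c) \<bullet> b = y b" if "b \<in> Basis" for y :: "'a \<Rightarrow> real" and b
    using that by (simp add: inner_sum_left inner_Basis if_distrib sum.delta cong: if_cong)
  have "(\<integral>x. (\<Prod>b\<in>Basis. f b (x \<bullet> b)) \<partial>lborel) =
        (\<integral>y. (\<Prod>b\<in>Basis. f b ((\<Sum>c\<in>Basis. y c *\<^sub>R c) \<bullet> b)) \<partial>(\<Pi>\<^sub>M b\<in>(Basis::'a set). lborel))"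
    by (subst lborel_eq, subst integral_distr) (auto intro!: borel_measurable_prod)
  also have "\<dots> = (\<integral>y. (\<Prod>b\<in>Basis. f b (y b)) \<partial>(\<Pi>\<^sub>M b\<in>(Basis::'a set). lborel))"
    by (intro Bochner_Integration.integral_cong prod.cong refl) (simp add: eq)
  also have "\<dots> = (\<Prod>b\<in>Basis. integral\<^sup>L lborel (f b))"
    by (rule product_integral_prod) (use assms in auto)
  finally show ?thesis .
qed

lemma integral_lborel_prod_cart:
  fixes f :: "'n::finite \<Rightarrow> real \<Rightarrow> complex"
  assumes "\<And>s. integrable lborel (f s)"
  shows "(\<integral>x. (\<Prod>s\<in>UNIV. f s (x $ s)) \<partial>(lborel :: (real^'n) measure)) = (\<Prod>s\<in>UNIV. integral\<^sup>L lborel (f s))"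
proof -
  define g where "g b = f (inv (\<lambda>s::'n. axis s (1::real)) b)" for b
  have inj: "inj (\<lambda>s::'n. axis s (1::real))"
    by (auto simp: inj_def axis_eq_axis)
  have B: "(Basis :: (real^'n) set) = range (\<lambda>s. axis s 1)"
    by (auto simp: Basis_vec_def)
  have g: "g (axis s 1) = f s" for s
    by (simp add: g_def inv_f_f[OF inj])
  have "(\<integral>x. (\<Prod>b\<in>Basis. g b (x \<bullet> b)) \<partial>(lborel :: (real^'n) measure)) = (\<Prod>b\<in>Basis. integral\<^sup>L lborel (g b))"
    by (rule integral_lborel_prod) (auto simp: g_def assms)
  then show ?thesis
    by (simp add: B prod.reindex[OF inj] g inner_axis)
qed

lemma unit_interval_character_integral:
  fixes n :: int
  shows "integrable lborel (\<lambda>t. indicat_real {0..<1} t *\<^sub>R exp (2 * of_real pi * \<i> * of_real (of_int n * t)))" (is "integrable _ ?g")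
    and "(LINT t|lborel. indicat_real {0..<1} t *\<^sub>R exp (2 * of_real pi * \<i> * of_real (of_int n * t))) = (if n = 0 then 1 else 0)"
proof -
  let ?e = "\<lambda>t::real. exp (2 * of_real pi * \<i> * of_real (of_int n * t))"
  have cont: "continuous_on A ?e" for A
    by (intro continuous_intros)
  have 1: "integrable lborel (\<lambda>t. indicat_real {0..1} t *\<^sub>R ?e t)"
    by (rule borel_integrable_compact[OF compact_Icc cont])
  \<comment> \<open>The half-open interval differs from the closed one by the null set {1}; on the
    closed one the fundamental theorem of calculus applies.\<close>
  have ae: "AE t in lborel. indicat_real {0..<1} t *\<^sub>R ?e t = indicat_real {0..1} t *\<^sub>R ?e t"
    using AE_lborel_singleton[of 1] by eventually_elim (auto simp: indicator_def)
  have [measurable]: "?e \<in> borel_measurable borel"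
    by (rule borel_measurable_continuous_onI[OF cont])
  have m: "?g \<in> borel_measurable lborel" "(\<lambda>t. indicat_real {0..1} t *\<^sub>R ?e t) \<in> borel_measurable lborel"
    by measurable
  show "integrable lborel ?g"
    using 1 integrable_cong_AE[OF m ae] by simp
  have "(LINT t|lborel. ?g t) = (LINT t|lborel. indicat_real {0..1} t *\<^sub>R ?e t)"
    by (rule integral_cong_AE[OF m ae])
  also have "\<dots> = (if n = 0 then 1 else 0)"
  proof (cases "n = 0")
    case False
    define c where "c = 2 * of_real pi * \<i> * (of_int n :: complex)"
    have c: "c \<noteq> 0" using False by (simp add: c_def)
    have ec: "?e t = exp (c * of_real t)" for t by (simp add: c_def mult.assoc)
    have "(LINT t|lborel. indicat_real {0..1} t *\<^sub>R ?e t) = exp (c * of_real 1) / c - exp (c * of_real 0) / c"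
    proof (rule integral_FTC_atLeastAtMost)
      fix x :: real assume "0 \<le> x" "x \<le> 1"
      have "((\<lambda>z. exp (c * z) / c) has_field_derivative exp (c * of_real x)) (at (of_real x))"
        using c by (auto intro!: derivative_eq_intros)
      then show "((\<lambda>t. exp (c * of_real t) / c) has_vector_derivative ?e x) (at x within {0..1})"
        unfolding ec by (rule has_vector_derivative_real_field)
    qed (use cont in \<open>simp_all del: of_real_mult\<close>)
    also have "exp c = 1"
    proof -
      have "exp c = cis (2 * pi * of_int n)"
        by (simp add: c_def cis_conv_exp mult_ac)
      then show ?thesis by simp
    qed
    then have "exp (c * of_real 1) / c - exp (c * of_real 0) / c = 0" by simp
    finally show ?thesis using False by simp
  next
    case True
    have "(LINT t|lborel. indicat_real {0..1::real} t *\<^sub>R (1::complex)) = 1"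
      by (subst integral_scaleR_left) (auto intro!: integrable_real_indicator)
    with True show ?thesis by simp
  qed
  finally show "(LINT t|lborel. ?g t) = (if n = 0 then 1 else 0)" .
qed

section \<open>Exponentials and their orthogonality\<close>

lemma freq_dot_add: "freq_dot (k + l) x = freq_dot k x + freq_dot l x"
  by (simp add: freq_dot_def sum.distrib algebra_simps)

lemma freq_dot_add_right: "freq_dot k (x + y) = freq_dot k x + freq_dot k y"
  by (simp add: freq_dot_def sum.distrib algebra_simps)

lemma fourier_exp_add: "fourier_exp (k + l) x = fourier_exp k x * fourier_exp l x"
  by (simp add: fourier_exp_def freq_dot_add ring_distribs exp_add)

lemma fourier_exp_0 [simp]: "fourier_exp 0 x = 1"
  by (simp add: fourier_exp_def freq_dot_def)

lemma fourier_exp_cis: "fourier_exp k x = cis (2 * pi * freq_dot k x)"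
  by (simp add: fourier_exp_def cis_conv_exp algebra_simps)

lemma norm_fourier_exp [simp]: "cmod (fourier_exp k x) = 1"
  by (simp add: fourier_exp_cis)

lemma continuous_fourier_exp [continuous_intros]: "continuous_on A (fourier_exp k)"
  unfolding fourier_exp_def freq_dot_def by (intro continuous_intros)

lemma periodic_fourier_exp: "periodic (fourier_exp k)"
  unfolding periodic_def
proof (intro allI)
  fix x :: "real^'a" and s
  have "(\<Sum>t\<in>UNIV. of_int (k $ t) * axis s 1 $ t) = (of_int (k $ s) :: real)"
    by (simp add: axis_def if_distrib cong: if_cong)
  then have "freq_dot k (x + axis s 1) = freq_dot k x + of_int (k $ s)"
    by (simp add: freq_dot_add_right) (simp add: freq_dot_def)
  then show "fourier_exp k (x + axis s 1) = fourier_exp k x"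
    by (simp add: fourier_exp_cis ring_distribs cis_mult[symmetric] cis_multiple_2pi)
qed

lemma integral_fourier_exp:
  "(LINT x:torus|lebesgue. fourier_exp k x) = (if k = 0 then 1 else 0)"
proof -
  let ?f = "\<lambda>s t. indicat_real {0..<1} t *\<^sub>R exp (2 * of_real pi * \<i> * of_real (of_int (k $ s) * t))"
  have "indicat_real torus x *\<^sub>R fourier_exp k x = (\<Prod>s\<in>UNIV. ?f s (x $ s))" for x
  proof (cases "x \<in> torus")
    case True
    then show ?thesis
      by (simp add: torus_def fourier_exp_def freq_dot_def sum_distrib_left exp_sum)
  next
    case False
    then obtain s where "x $ s \<notin> {0..<1}" by (auto simp: torus_def)
    then have "?f s (x $ s) = 0" by (simp only: indicator_simps(2) scaleR_zero_left not_False_eq_True)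
    with False show ?thesis by (metis (mono_tags, lifting) UNIV_I finite indicator_simps(2) prod_zero scaleR_zero_left)
  qed
  then have "(LINT x:torus|lborel. fourier_exp k x) = (\<integral>x. (\<Prod>s\<in>UNIV. ?f s (x $ s)) \<partial>lborel)"
    by (simp add: set_lebesgue_integral_def)
  also have "\<dots> = (\<Prod>s\<in>UNIV. if k $ s = 0 then 1 else 0)"
    by (subst integral_lborel_prod_cart[OF unit_interval_character_integral(1)])
       (simp only: unit_interval_character_integral(2))
  also have "\<dots> = (if k = 0 then 1 else 0)"
    by (auto simp: vec_eq_iff)
  finally show ?thesis
    by (simp add: set_integral_lebesgue_eq_lborel[OF continuous_fourier_exp])
qed

lemma continuous_trig_sum: "continuous_on A (\<lambda>x. \<Sum>k\<in>I. c k * fourier_exp k x)"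
  by (intro continuous_intros)

lemma fourier_coeff_trig_sum:
  assumes "finite I"
  shows "fourier_coeff (\<lambda>x. \<Sum>k\<in>I. c k * fourier_exp k x) l = (if l \<in> I then c l else 0)"
proof -
  have "fourier_coeff (\<lambda>x. \<Sum>k\<in>I. c k * fourier_exp k x) l =
        (LINT x:torus|lebesgue. (\<Sum>k\<in>I. c k * fourier_exp (k - l) x))"
    by (simp add: fourier_coeff_def sum_distrib_right mult.assoc fourier_exp_add[symmetric])
  also have "\<dots> = (\<Sum>k\<in>I. LINT x:torus|lebesgue. c k * fourier_exp (k - l) x)"
    unfolding set_lebesgue_integral_def scaleR_sum_right
    by (intro Bochner_Integration.integral_sum)
       (auto intro!: continuous_integrable_torus(1)[unfolded set_integrable_def] continuous_intros)
  also have "\<dots> = (\<Sum>k\<in>I. if k = l then c l else 0)"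
    by (intro sum.cong refl) (simp add: integral_fourier_exp)
  also have "\<dots> = (if l \<in> I then c l else 0)"
    using assms by simp
  finally show ?thesis .
qed

lemma fourier_coeff_diff:
  assumes "continuous_on UNIV f" "continuous_on UNIV g"
  shows "fourier_coeff (\<lambda>x. f x - g x) k = fourier_coeff f k - fourier_coeff g k"
  unfolding fourier_coeff_def left_diff_distrib
  by (intro set_integral_diff continuous_integrable_torus continuous_intros assms)

lemma norm_torus_integral_le:
  fixes f :: "real^'n::finite \<Rightarrow> complex"
  assumes "continuous_on UNIV f" "\<And>x. cmod (f x) \<le> B"
  shows "cmod (LINT x:torus|lebesgue. f x) \<le> B"
proof -
  have "cmod (LINT x:torus|lebesgue. f x) \<le> (LINT x:torus|lebesgue. cmod (f x))"
    by (rule set_integral_norm_bound[OF continuous_integrable_torus(1)[OF assms(1)]])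
  also have "\<dots> \<le> (LINT x:(torus::(real^'n) set)|lebesgue. B)"
    by (rule set_integral_mono) (auto intro!: continuous_integrable_torus continuous_intros assms)
  also have "\<dots> = B"
  proof -
    \<comment> \<open>The torus has measure 1: this is the integral of the exponential of frequency
      0.\<close>
    have "complex_of_real (LINT x:(torus::(real^'n) set)|lebesgue. 1) = (LINT x:(torus::(real^'n) set)|lebesgue. complex_of_real 1)"
      by (rule set_integral_complex_of_real[symmetric])
    also have "\<dots> = (LINT x:(torus::(real^'n) set)|lebesgue. fourier_exp 0 x)"
      by (simp only: fourier_exp_0 of_real_1)
    also have "\<dots> = 1" by (subst integral_fourier_exp) (rule if_P, rule refl)
    finally have "(LINT x:(torus::(real^'n) set)|lebesgue. 1) = (1::real)"
      by (simp only: of_real_eq_1_iff)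
    then show ?thesis
      using set_integral_mult_right[where a = B and f = "\<lambda>_. 1" and A = "torus :: (real^'n) set" and M = lebesgue] by simp
  qed
  finally show ?thesis .
qed

lemma norm_fourier_coeff_le:
  assumes "continuous_on UNIV f" "\<And>x. cmod (f x) \<le> B"
  shows "cmod (fourier_coeff f k) \<le> B"
  unfolding fourier_coeff_def
  by (rule norm_torus_integral_le) (intro continuous_intros assms(1), simp add: norm_mult assms(2))

section \<open>Density of trigonometric polynomials and uniqueness of Fourier coefficients\<close>

inductive_set trig_alg :: "(real^'n::finite \<Rightarrow> complex) set" where
  exp: "fourier_exp k \<in> trig_alg"
| scale: "p \<in> trig_alg \<Longrightarrow> (\<lambda>x. c * p x) \<in> trig_alg"
| add: "p \<in> trig_alg \<Longrightarrow> q \<in> trig_alg \<Longrightarrow> (\<lambda>x. p x + q x) \<in> trig_alg"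

lemma trig_alg_const: "(\<lambda>x. c) \<in> trig_alg"
  using trig_alg.scale[OF trig_alg.exp[of 0], of c] by simp

lemma trig_alg_exp_mult: "p \<in> trig_alg \<Longrightarrow> (\<lambda>x. fourier_exp k x * p x) \<in> trig_alg"
proof (induction rule: trig_alg.induct)
  case (exp l)
  show ?case using trig_alg.exp[of "k + l"] by (simp add: fourier_exp_add[abs_def])
next
  case (scale p c)
  from trig_alg.scale[OF scale.IH, of c] show ?case by (simp add: mult_ac)
next
  case (add p q)
  from trig_alg.add[OF add.IH] show ?case by (simp add: ring_distribs)
qed

text \<open>Closure under products is what places polynomials in sines and cosines in this class.
  Generating \<open>trig_alg\<close> inductively, rather than as sums over finite index sets,
  reduces it to a rule induction on the left factor.\<close>

lemma trig_alg_mult: "p \<in> trig_alg \<Longrightarrow> q \<in> trig_alg \<Longrightarrow> (\<lambda>x. p x * q x) \<in> trig_alg"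
proof (induction rule: trig_alg.induct)
  case (exp k)
  then show ?case by (rule trig_alg_exp_mult)
next
  case (scale p c)
  from trig_alg.scale[OF scale.IH[OF scale.prems], of c] show ?case by (simp add: mult_ac)
next
  case (add p p')
  from trig_alg.add[OF add.IH(1)[OF add.prems] add.IH(2)[OF add.prems]] show ?case by (simp add: ring_distribs)
qed

lemma trig_alg_sum:
  "finite A \<Longrightarrow> (\<And>i. i \<in> A \<Longrightarrow> p i \<in> trig_alg) \<Longrightarrow> (\<lambda>x. \<Sum>i\<in>A. p i x) \<in> trig_alg"
proof (induction rule: finite_induct)
  case empty
  show ?case using trig_alg_const[of 0] by simp
next
  case (insert i A)
  then have "(\<lambda>x. p i x + (\<Sum>i\<in>A. p i x)) \<in> trig_alg"
    by (intro trig_alg.add) simp_all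
  with insert show ?case by simp
qed

lemma trig_alg_continuous: "p \<in> trig_alg \<Longrightarrow> continuous_on A p"
  by (induction rule: trig_alg.induct) (auto intro!: continuous_intros)

text \<open>The torus as a product of unit circles: points have the same image exactly when they
  differ by an integer vector. It supplies the compact subset of a Euclidean space that
  Stone-Weierstrass needs.\<close>

definition torus_embed :: "real^'n::finite \<Rightarrow> complex^'n" where
  "torus_embed x = (\<chi> s. cis (2 * pi * x $ s))"

lemma freq_dot_axis: "freq_dot (axis s m) x = of_int m * x $ s"
proof -
  have "freq_dot (axis s m) x = (\<Sum>t\<in>UNIV. if t = s then of_int m * x $ s else 0)"
    unfolding freq_dot_def axis_def by (intro sum.cong) auto
  then show ?thesis by simp
qed

lemma fourier_exp_axis: "fourier_exp (axis s m) x = cis (2 * pi * (of_int m * x $ s))"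
  by (simp add: fourier_exp_cis freq_dot_axis)

text \<open>A real-linear functional of \<open>torus_embed x\<close> is a combination of
  \<open>cos\<close> and \<open>sin\<close> of the coordinates, and these are combinations of two
  exponentials along an axis; all other polynomials follow by closure.\<close>

lemma trig_alg_polynomial:
  "real_polynomial_function p \<Longrightarrow> (\<lambda>x. complex_of_real (p (torus_embed x))) \<in> trig_alg"
proof (induction rule: real_polynomial_function.induct)
  case (linear f)
  interpret bounded_linear f by fact
  have cos_eq: "complex_of_real (cos (2 * pi * x $ s)) = 1/2 * (fourier_exp (axis s 1) x + fourier_exp (axis s (-1)) x)"
    for x :: "real^'a" and s
    by (simp add: fourier_exp_axis complex_eq_iff)
  have sin_eq: "complex_of_real (sin (2 * pi * x $ s)) = (- \<i> / 2) * (fourier_exp (axis s 1) x + (-1) * fourier_exp (axis s (-1)) x)"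
    for x :: "real^'a" and s
    by (simp add: fourier_exp_axis complex_eq_iff)
  have embed: "torus_embed x = (\<Sum>s\<in>UNIV. cos (2 * pi * x $ s) *\<^sub>R axis s 1 + sin (2 * pi * x $ s) *\<^sub>R axis s \<i>)"
    for x :: "real^'a"
  proof -
    have "cis (2 * pi * x $ t) = (\<Sum>s\<in>UNIV. if s = t then cis (2 * pi * x $ t) else 0)" for t
      by simp
    also have "\<dots> t = (\<Sum>s\<in>UNIV. (cos (2 * pi * x $ s) *\<^sub>R axis s 1 + sin (2 * pi * x $ s) *\<^sub>R axis s \<i>) $ t)" for t
      by (intro sum.cong refl) (auto simp: axis_def complex_eq_iff)
    finally show ?thesis by (simp add: vec_eq_iff torus_embed_def sum_component)
  qed
  have "complex_of_real (f (torus_embed x)) =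
      (\<Sum>s\<in>UNIV. of_real (f (axis s 1)) * of_real (cos (2 * pi * x $ s)) +
                 of_real (f (axis s \<i>)) * of_real (sin (2 * pi * x $ s)))" for x
    by (simp add: embed sum add scaleR mult.commute)
  then show ?case
    unfolding cos_eq sin_eq by (simp only:) (intro trig_alg_sum finite trig_alg.intros)
next
  case (const c)
  show ?case by (rule trig_alg_const)
next
  case (add p q)
  from trig_alg.add[OF add.IH] show ?case by simp
next
  case (mult p q)
  from trig_alg_mult[OF mult.IH] show ?case by simp
qed

lemma periodic_int_shift_axis:
  assumes "periodic f"
  shows "f (x + of_int m *\<^sub>R axis s 1) = f x"
proof -
  have nat: "f (y + of_nat n *\<^sub>R axis s 1) = f y" for y n
  proof (induction n)
    case (Suc n)
    have "f (y + of_nat (Suc n) *\<^sub>R axis s 1) = f ((y + of_nat n *\<^sub>R axis s 1) + axis s 1)"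
      by (simp add: algebra_simps)
    also have "\<dots> = f y" using assms Suc by (simp add: periodic_def)
    finally show ?case .
  qed simp
  show ?thesis
  proof (cases "m \<ge> 0")
    case True
    then show ?thesis using nat[of x "nat m"] by simp
  next
    case False
    then show ?thesis using nat[of "x + of_int m *\<^sub>R axis s 1" "nat (- m)"] by simp
  qed
qed

lemma periodic_int_shift:
  assumes "periodic f" "\<And>s. x $ s - y $ s \<in> \<int>"
  shows "f x = f y"
proof -
  have "\<forall>s. \<exists>m. x $ s - y $ s = of_int m"
    using assms(2) by (auto elim: Ints_cases)
  then obtain m where m: "\<And>s. x $ s - y $ s = of_int (m s)"
    by metis
  have fin: "f (y + (\<Sum>s\<in>A. of_int (m s) *\<^sub>R axis s 1)) = f y" if "finite A" for A
    using that
  proof (induction A rule: finite_induct)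
    case (insert s A)
    have "y + (\<Sum>s\<in>insert s A. of_int (m s) *\<^sub>R axis s 1) =
          (y + (\<Sum>s\<in>A. of_int (m s) *\<^sub>R axis s 1)) + of_int (m s) *\<^sub>R axis s 1"
      using insert by (simp add: algebra_simps)
    then show ?case
      by (simp only: periodic_int_shift_axis[OF assms(1)] insert.IH)
  qed simp
  define v where "v = (\<Sum>s\<in>UNIV. of_int (m s) *\<^sub>R axis s (1::real))"
  have "v $ t = x $ t - y $ t" for t
    unfolding v_def m by (simp add: sum_component axis_def if_distrib cong: if_cong)
  then have "y + v = x" by (simp add: vec_eq_iff)
  moreover have "f (y + v) = f y"
    unfolding v_def by (rule fin[OF finite])
  ultimately show ?thesis by simp
qed

lemma torus_embed_eq_imp: "torus_embed x = torus_embed y \<Longrightarrow> x $ s - y $ s \<in> \<int>"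
proof -
  assume "torus_embed x = torus_embed y"
  then have "cis (2 * pi * x $ s) = cis (2 * pi * y $ s)"
    by (simp add: torus_embed_def vec_eq_iff)
  then have "cis (2 * pi * x $ s - 2 * pi * y $ s) = 1"
    by (simp flip: cis_divide)
  then have "cos (2 * pi * (x $ s - y $ s)) = 1"
    by (simp add: complex_eq_iff algebra_simps)
  then obtain n :: int where "2 * pi * (x $ s - y $ s) = of_int n * 2 * pi"
    by (auto simp: cos_one_2pi_int)
  then have "x $ s - y $ s = of_int n" by simp
  then show ?thesis by simp
qed

lemma continuous_torus_embed: "continuous_on A torus_embed"
  unfolding torus_embed_def by (intro continuous_intros)

lemma ex_cbox_torus_embed: "\<exists>y\<in>cbox 0 1. torus_embed y = torus_embed (x :: real^'n::finite)"
proof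
  show "(\<chi> s. frac (x $ s)) \<in> cbox 0 1"
    by (auto simp: mem_box_cart less_imp_le frac_lt_1)
  have "cis (2 * pi * frac t) = cis (2 * pi * t)" for t
  proof -
    have "2 * pi * t = 2 * pi * frac t + 2 * pi * of_int \<lfloor>t\<rfloor>"
      by (simp add: frac_def algebra_simps)
    then have "cis (2 * pi * t) = cis (2 * pi * frac t) * cis (2 * pi * of_int \<lfloor>t\<rfloor>)"
      by (simp only: cis_mult)
    then show ?thesis by simp
  qed
  then show "torus_embed (\<chi> s. frac (x $ s)) = torus_embed x"
    by (simp add: torus_embed_def vec_eq_iff)
qed

text \<open>The graph of the factor is the image of a cube under a continuous map, hence compact; this makes
  the factor continuous although \<open>torus_embed\<close> has no continuous inverse.\<close>

lemma periodic_factors_through_embed: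
  fixes f :: "real^'n::finite \<Rightarrow> complex"
  assumes "periodic f" "continuous_on UNIV f"
  shows "\<exists>F. continuous_on (torus_embed ` cbox (0::real^'n) 1) F \<and> (\<forall>x. F (torus_embed x) = f x)"
proof -
  define F where "F z = f (SOME y. torus_embed y = z)" for z
  have F: "F (torus_embed x) = f x" for x
  proof -
    have "torus_embed (SOME y. torus_embed y = torus_embed x) = torus_embed x"
      by (rule someI) (rule refl)
    from periodic_int_shift[OF assms(1) torus_embed_eq_imp[OF this]] show ?thesis
      by (simp add: F_def)
  qed
  let ?S = "torus_embed ` cbox (0::real^'n) 1"
  have "(\<lambda>z. (z, F z)) ` ?S = (\<lambda>x. (torus_embed x, f x)) ` cbox 0 1"
    by (simp add: image_image F)
  moreover have "compact \<dots>"
    by (intro compact_continuous_image continuous_on_Pair continuous_torus_embed compact_cbox)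
       (rule continuous_on_subset[OF assms(2)], simp)
  ultimately have "closed ((\<lambda>z. (z, F z)) ` ?S)"
    by (simp add: compact_imp_closed)
  moreover have "compact (f ` cbox 0 1)"
    by (intro compact_continuous_image compact_cbox continuous_on_subset[OF assms(2)]) simp
  ultimately have "continuous_on ?S F"
    by (subst continuous_closed_graph_eq[of "f ` cbox 0 1"])
       (auto simp: F intro!: closed_subset)
  with F show ?thesis by blast
qed

text \<open>The factor of \<open>f\<close> is approximated by a polynomial on the image of the cube.
  The cube meets every class modulo integer vectors, so the bound holds at every
  \<open>x\<close>.\<close>

lemma trig_alg_dense:
  fixes f :: "real^'n::finite \<Rightarrow> complex"
  assumes "periodic f" "continuous_on UNIV f" "e > 0"
  shows "\<exists>p\<in>trig_alg. \<forall>x. cmod (f x - p x) < e"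
proof -
  obtain F where F: "continuous_on (torus_embed ` cbox (0::real^'n) 1) F" "\<And>x. F (torus_embed x) = f x"
    using periodic_factors_through_embed[OF assms(1,2)] by blast
  have "compact (torus_embed ` cbox (0::real^'n) 1)"
    by (intro compact_continuous_image continuous_torus_embed compact_cbox)
  from Stone_Weierstrass_polynomial_function[OF this F(1) assms(3)]
  obtain g where g: "polynomial_function g" "\<forall>z\<in>torus_embed ` cbox (0::real^'n) 1. norm (F z - g z) < e"
    by auto
  have "real_polynomial_function (\<lambda>z. Re (g z))" "real_polynomial_function (\<lambda>z. Im (g z))"
    using g(1) bounded_linear_Re bounded_linear_Im unfolding polynomial_function_def o_def by blast+
  from this[THEN trig_alg_polynomial]
  have "(\<lambda>x. of_real (Re (g (torus_embed x))) + \<i> * of_real (Im (g (torus_embed x)))) \<in> trig_alg"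
    by (intro trig_alg.add trig_alg.scale)
  then have "(\<lambda>x. g (torus_embed x)) \<in> trig_alg"
    by (simp only: complex_eq[symmetric])
  moreover have "cmod (f x - g (torus_embed x)) < e" for x
  proof -
    obtain y where "y \<in> cbox 0 1" "torus_embed y = torus_embed x"
      using ex_cbox_torus_embed[of x] by blast
    then show ?thesis using g(2) F(2)[of x] by force
  qed
  ultimately show ?thesis
    by (intro bexI[of _ "\<lambda>x. g (torus_embed x)"] allI)
qed

lemma integral_mult_trig_alg_eq_0:
  assumes "continuous_on UNIV f" "\<And>k. fourier_coeff f k = 0" "p \<in> trig_alg"
  shows "(LINT x:torus|lebesgue. f x * p x) = 0"
  using assms(3)
proof (induction rule: trig_alg.induct)
  case (exp k)
  show ?case using assms(2)[of "- k"] by (simp add: fourier_coeff_def)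
next
  case (scale p c)
  then have "(LINT x:torus|lebesgue. c * (f x * p x)) = 0" by simp
  then show ?case by (simp add: mult_ac)
next
  case (add p q)
  have "set_integrable lebesgue torus (\<lambda>x. f x * r x)" if "r \<in> trig_alg" for r
    by (intro continuous_integrable_torus continuous_on_mult assms(1) trig_alg_continuous that)
  with add have "(LINT x:torus|lebesgue. f x * p x + f x * q x) = 0"
    by (subst set_integral_add) simp_all
  then show ?case by (simp add: ring_distribs)
qed

text \<open>\<open>f\<close> integrates to 0 against every trigonometric polynomial, and these
  approximate the conjugate of \<open>f\<close> uniformly, so the integral of its squared modulus is
  0. Continuity then gives vanishing at every point, not only almost everywhere.\<close>

lemma fourier_coeff_zero_imp_zero:
  fixes f :: "real^'n::finite \<Rightarrow> complex"
  assumes "periodic f" "continuous_on UNIV f" "\<And>k. fourier_coeff f k = 0"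
  shows "f x = 0"
proof -
  have cont: "continuous_on A f" for A
    using assms(2) continuous_on_subset by blast
  have factor: "\<exists>y\<in>cbox 0 1. f x = f y" for x
    
  proof -
    obtain y where y: "y \<in> cbox 0 1" "torus_embed x = torus_embed y"
      using ex_cbox_torus_embed[of x] by metis
    from periodic_int_shift[OF assms(1) torus_embed_eq_imp[OF y(2)]] y(1) show ?thesis by blast
  qed
  have "compact (f ` cbox 0 1)"
    by (intro compact_continuous_image compact_cbox cont)
  then have "bounded (f ` cbox 0 1)" by (rule compact_imp_bounded)
  then obtain B where B: "B > 0" "\<forall>z\<in>f ` cbox 0 1. cmod z \<le> B"
    unfolding bounded_pos by blast
  have Bf: "cmod (f x) \<le> B" for x
    using factor[of x] B(2) by auto
  have cp: "periodic (\<lambda>x. cnj (f x))" "continuous_on UNIV (\<lambda>x. cnj (f x))"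
    using assms(1) by (auto simp: periodic_def intro!: continuous_intros cont)
  define I where "I = (LINT x:torus|lebesgue. (cmod (f x))\<^sup>2)"
  have I: "complex_of_real I = (LINT x:torus|lebesgue. f x * cnj (f x))"
    unfolding I_def set_integral_complex_of_real[symmetric] by (simp only: complex_norm_square)
  have "I \<le> e" if e: "e > 0" for e
  proof -
    obtain p where p: "p \<in> trig_alg" "\<And>x. cmod (cnj (f x) - p x) < e / B"
      using trig_alg_dense[OF cp divide_pos_pos[OF e B(1)]] by blast
    have cpp: "continuous_on A p" for A by (rule trig_alg_continuous[OF p(1)])
    have "set_integrable lebesgue torus (\<lambda>x. f x * cnj (f x))" "set_integrable lebesgue torus (\<lambda>x. f x * p x)"
      by (intro continuous_integrable_torus continuous_intros cont cpp)+
    then have "(LINT x:torus|lebesgue. f x * (cnj (f x) - p x)) = complex_of_real I"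
      unfolding I right_diff_distrib
      by (subst set_integral_diff) (simp_all add: integral_mult_trig_alg_eq_0[OF assms(2,3) p(1)])
    moreover have "cmod (LINT x:torus|lebesgue. f x * (cnj (f x) - p x)) \<le> e"
    proof (rule norm_torus_integral_le)
      fix x
      have "cmod (f x * (cnj (f x) - p x)) \<le> B * (e / B)"
        unfolding norm_mult by (intro mult_mono Bf less_imp_le[OF p(2)]) (use B(1) in simp_all)
      then show "cmod (f x * (cnj (f x) - p x)) \<le> e" using B(1) by simp
    qed (intro continuous_intros cont cpp)
    ultimately show ?thesis by simp
  qed
  then have "I \<le> 0" by (rule dense_ge)
  moreover have "I \<ge> 0" by (simp add: I_def set_lebesgue_integral_def)
  ultimately have I0: "I = 0" by simp
  have sq: "continuous_on A (\<lambda>x. (cmod (f x))\<^sup>2)" for A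
    by (intro continuous_intros cont)
  \<comment> \<open>Pointwise vanishing is concluded on a closed cube, so the integral is moved from
    \<open>torus\<close> to \<open>cbox 0 1\<close>; the two differ only in part of the negligible
    boundary.\<close>
  have "((\<lambda>x. (cmod (f x))\<^sup>2) has_integral 0) torus"
    using has_integral_set_lebesgue[OF continuous_integrable_torus(1)[OF sq]] I0
    by (simp add: I_def)
  moreover have "((\<lambda>x. (cmod (f x))\<^sup>2) has_integral 0) torus \<longleftrightarrow> ((\<lambda>x. (cmod (f x))\<^sup>2) has_integral 0) (cbox 0 1)"
  proof (rule has_integral_spike_set_eq)
    have box: "box 0 1 \<subseteq> (torus :: (real^'n) set)"
      by (auto simp: torus_def mem_box_cart less_imp_le)
    show "negligible {x \<in> torus - cbox 0 1. (cmod (f x))\<^sup>2 \<noteq> 0}"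
      by (intro negligible_subset[OF negligible_empty]) (use torus_subset_cbox in blast)
    show "negligible {x \<in> cbox 0 1 - torus. (cmod (f x))\<^sup>2 \<noteq> 0}"
      using box by (intro negligible_subset[OF negligible_frontier_interval[of 0 1]]) blast
  qed
  ultimately have zero: "(cmod (f y))\<^sup>2 = 0" if "y \<in> cbox 0 1" for y
    by (intro has_integral_0_cbox_imp_0[OF sq _ _ _ that]) (simp_all add: interval_ne_empty_cart)
  from factor[of x] zero show ?thesis by auto
qed

section \<open>Absolutely convergent Fourier series\<close>

lemma fourier_series_uniform:
  fixes c :: "int^'n::finite \<Rightarrow> complex"
  assumes "(\<lambda>k. cmod (c k)) summable_on UNIV"
  shows "uniform_limit UNIV (\<lambda>F x. \<Sum>k\<in>F. c k * fourier_exp k x)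
           (\<lambda>x. \<Sum>\<^sub>\<infinity>k. c k * fourier_exp k x) (finite_subsets_at_top UNIV)"
  by (rule Weierstrass_m_test_general[OF _ assms]) (simp add: norm_mult)

lemma continuous_fourier_series:
  fixes c :: "int^'n::finite \<Rightarrow> complex"
  assumes "(\<lambda>k. cmod (c k)) summable_on UNIV"
  shows "continuous_on UNIV (\<lambda>x. \<Sum>\<^sub>\<infinity>k. c k * fourier_exp k x)"
  by (rule uniform_limit_theorem[OF always_eventually fourier_series_uniform[OF assms]])
     (simp_all add: continuous_trig_sum)

text \<open>A coefficient depends continuously on the function in the uniform norm, and every
  partial sum whose index set contains \<open>l\<close> has exactly the coefficient
  \<open>c l\<close>.\<close>

lemma fourier_coeff_series:
  fixes c :: "int^'n::finite \<Rightarrow> complex"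
  assumes "(\<lambda>k. cmod (c k)) summable_on UNIV"
  shows "fourier_coeff (\<lambda>x. \<Sum>\<^sub>\<infinity>k. c k * fourier_exp k x) l = c l"
proof -
  let ?g = "\<lambda>x. \<Sum>\<^sub>\<infinity>k. c k * fourier_exp k x"
  have le: "cmod (fourier_coeff ?g l - c l) \<le> e" if "e > 0" for e
  proof -
    have "\<forall>\<^sub>F F in finite_subsets_at_top UNIV. \<forall>x\<in>UNIV. dist (\<Sum>k\<in>F. c k * fourier_exp k x) (?g x) < e"
      using uniform_limitD[OF fourier_series_uniform[OF assms] that] .
    moreover have "\<forall>\<^sub>F F in finite_subsets_at_top UNIV. finite F \<and> {l} \<subseteq> F"
      unfolding eventually_finite_subsets_at_top by blast
    ultimately have "\<forall>\<^sub>F F in finite_subsets_at_top UNIV. (\<forall>x. dist (\<Sum>k\<in>F. c k * fourier_exp k x) (?g x) < e) \<and> finite F \<and> l \<in> F"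
      by eventually_elim simp
    from eventually_happens'[OF finite_subsets_at_top_neq_bot this]
    obtain F where F: "finite F" "l \<in> F" "\<And>x. dist (\<Sum>k\<in>F. c k * fourier_exp k x) (?g x) < e"
      by blast
    have "fourier_coeff ?g l - c l = fourier_coeff (\<lambda>x. ?g x - (\<Sum>k\<in>F. c k * fourier_exp k x)) l"
      by (subst fourier_coeff_diff[OF continuous_fourier_series[OF assms] continuous_trig_sum])
         (simp add: fourier_coeff_trig_sum F(1,2))
    also have "cmod \<dots> \<le> e"
      using F(3) by (intro norm_fourier_coeff_le continuous_on_diff continuous_fourier_series[OF assms] continuous_trig_sum)
        (simp add: dist_norm norm_minus_commute less_imp_le)
    finally show ?thesis .
  qed
  have "cmod (fourier_coeff ?g l - c l) \<le> 0"
    by (rule dense_ge) (rule le)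
  then show ?thesis by (simp only: norm_le_zero_iff right_minus_eq)
qed

lemma periodic_fourier_series: "periodic (\<lambda>x. \<Sum>\<^sub>\<infinity>k. c k * fourier_exp k x)"
  unfolding periodic_def by (simp add: periodic_fourier_exp[unfolded periodic_def])

text \<open>\<open>f\<close> and its series are continuous with equal coefficients, so they agree
  everywhere. This is what allows the values at lattice nodes to be expanded.\<close>

lemma fourier_series_pointwise:
  fixes f :: "real^'n::finite \<Rightarrow> complex"
  assumes "periodic f" "continuous_on UNIV f" "(\<lambda>k. cmod (fourier_coeff f k)) summable_on UNIV"
  shows "((\<lambda>k. fourier_coeff f k * fourier_exp k x) has_sum f x) UNIV"
proof -
  let ?g = "\<lambda>x. \<Sum>\<^sub>\<infinity>k. fourier_coeff f k * fourier_exp k x"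
  have "f x - ?g x = 0"
  proof (rule fourier_coeff_zero_imp_zero)
    show "periodic (\<lambda>x. f x - ?g x)"
      using assms(1) periodic_fourier_series[of "fourier_coeff f"] by (simp add: periodic_def)
    show "continuous_on UNIV (\<lambda>x. f x - ?g x)"
      by (intro continuous_on_diff assms(2) continuous_fourier_series[OF assms(3)])
    show "fourier_coeff (\<lambda>x. f x - ?g x) k = 0" for k
      by (simp add: fourier_coeff_diff assms(2) continuous_fourier_series[OF assms(3)] fourier_coeff_series[OF assms(3)])
  qed
  moreover have "(\<lambda>k. fourier_coeff f k * fourier_exp k x) summable_on UNIV"
    by (rule abs_summable_summable) (simp add: norm_mult assms(3))
  ultimately show ?thesis by (simp add: has_sum_iff)
qed

lemma L2_torus_continuous:
  fixes f :: "real^'n::finite \<Rightarrow> complex"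
  assumes "periodic f" "continuous_on UNIV f"
  shows "f \<in> L2_torus"
proof -
  have "f \<in> borel_measurable lebesgue"
    using borel_measurable_continuous_onI[OF assms(2)] by (auto intro: measurable_completion)
  moreover have "set_integrable lebesgue torus (\<lambda>x. (cmod (f x))\<^sup>2)"
    by (intro continuous_integrable_torus continuous_intros assms(2))
  ultimately show ?thesis by (simp add: L2_torus_def assms(1))
qed

lemma periodic_diff: "periodic f \<Longrightarrow> periodic g \<Longrightarrow> periodic (\<lambda>x. f x - g x)"
  by (simp add: periodic_def)

lemma periodic_trig_sum: "periodic (\<lambda>x. \<Sum>k\<in>I. c k * fourier_exp k x)"
  unfolding periodic_def by (simp add: periodic_fourier_exp[unfolded periodic_def])

section \<open>Counting in dyadic blocks\<close>

text \<open>The index of the dyadic block containing \<open>n\<close>. It turns membership in a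
  block into an equation and membership in the cross into a bound on a sum of levels.\<close>

definition lev :: "int \<Rightarrow> nat" where
  "lev n = (LEAST j. \<bar>n\<bar> \<le> 2 ^ j)"

lemma abs_le_lev: "\<bar>n\<bar> \<le> 2 ^ lev n"
proof -
  have "\<bar>n\<bar> \<le> 2 ^ nat \<bar>n\<bar>"
    using of_nat_less_two_power[of "nat \<bar>n\<bar>", where 'a = int] by simp
  then show ?thesis unfolding lev_def by (rule LeastI)
qed

lemma lev_le: "\<bar>n\<bar> \<le> 2 ^ j \<Longrightarrow> lev n \<le> j"
  unfolding lev_def by (rule Least_le)

lemma lev_gt: "j < lev n \<Longrightarrow> 2 ^ j < \<bar>n\<bar>"
  using lev_le[of n j] by linarith

lemma lev_eq_iff: "lev n = j \<longleftrightarrow> \<bar>n\<bar> \<le> 2 ^ j \<and> (j = 0 \<or> 2 ^ (j - 1) < \<bar>n\<bar>)"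
proof
  assume j: "lev n = j"
  then show "\<bar>n\<bar> \<le> 2 ^ j \<and> (j = 0 \<or> 2 ^ (j - 1) < \<bar>n\<bar>)"
    using abs_le_lev[of n] lev_gt[of "j - 1" n] by (cases j) auto
next
  assume n: "\<bar>n\<bar> \<le> 2 ^ j \<and> (j = 0 \<or> 2 ^ (j - 1) < \<bar>n\<bar>)"
  have "j \<le> lev n"
  proof (rule ccontr)
    assume *: "\<not> j \<le> lev n"
    then have "(2::int) ^ lev n \<le> 2 ^ (j - 1)" by (intro power_increasing) auto
    moreover have "2 ^ (j - 1) < \<bar>n\<bar>" using n * by auto
    ultimately show False using abs_le_lev[of n] by linarith
  qed
  with lev_le[of n j] n show "lev n = j" by simp
qed

lemma dyadic_block_iff: "n \<in> dyadic_block j \<longleftrightarrow> lev n = j"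
proof -
  have *: "\<bar>n\<bar> \<le> b \<and> a < \<bar>n\<bar> \<longleftrightarrow> n \<in> {- b..- a - 1} \<union> {a + 1..b}" if "0 < a" for a b :: int
    using that by auto
  show ?thesis
    unfolding lev_eq_iff dyadic_block_def using *[of "2 ^ (j - 1)" "2 ^ j"] by auto
qed

definition total_lev :: "int ^ 'n::finite \<Rightarrow> nat" where
  "total_lev k = (\<Sum>s\<in>UNIV. lev (k $ s))"

text \<open>Sums of levels are integers, so a real refinement acts only through its floor.\<close>

definition cross_radius :: "real \<Rightarrow> nat \<Rightarrow> nat" where
  "cross_radius R d = nat \<lfloor>R\<rfloor> + d - 1"

lemma hyperbolic_cross_iff:
  assumes "R \<ge> 1"
  shows "(k :: int ^ 'n::finite) \<in> hyperbolic_cross R \<longleftrightarrow> total_lev k \<le> cross_radius R CARD('n)"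
proof -
  have d: "CARD('n) \<ge> 1" by (simp add: Suc_leI)
  have "real m \<le> R + real CARD('n) - 1 \<longleftrightarrow> m \<le> cross_radius R CARD('n)" for m
  proof -
    have "real m \<le> R + real CARD('n) - 1 \<longleftrightarrow> real_of_int (int m - int CARD('n) + 1) \<le> R" by auto
    also have "\<dots> \<longleftrightarrow> int m - int CARD('n) + 1 \<le> \<lfloor>R\<rfloor>" by (simp only: le_floor_iff)
    also have "\<dots> \<longleftrightarrow> m \<le> cross_radius R CARD('n)"
    proof -
      have "\<lfloor>R\<rfloor> \<ge> 0" using assms by simp
      then show ?thesis using d unfolding cross_radius_def by linarith
    qed
    finally show ?thesis .
  qed
  then have "cross_levels R = {j :: nat ^ 'n. (\<Sum>s\<in>UNIV. j $ s) \<le> cross_radius R CARD('n)}"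
    by (simp add: cross_levels_def del: of_nat_sum)
  then have "k \<in> hyperbolic_cross R \<longleftrightarrow>
      (\<exists>j :: nat ^ 'n. (\<Sum>s\<in>UNIV. j $ s) \<le> cross_radius R CARD('n) \<and> (\<forall>s. lev (k $ s) = j $ s))"
    by (auto simp: hyperbolic_cross_def dyadic_block_iff)
  also have "\<dots> \<longleftrightarrow> total_lev k \<le> cross_radius R CARD('n)"
  proof
    assume "total_lev k \<le> cross_radius R CARD('n)"
    then show "\<exists>j :: nat ^ 'n. (\<Sum>s\<in>UNIV. j $ s) \<le> cross_radius R CARD('n) \<and> (\<forall>s. lev (k $ s) = j $ s)"
      by (intro exI[of _ "\<chi> s. lev (k $ s)"]) (simp add: total_lev_def)
  qed (auto simp: total_lev_def)
  finally show ?thesis .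
qed

text \<open>A block of positive level starts just above half of its largest element; this costs the
  factor 4.\<close>

lemma one_plus_sq_ge_lev: "4 ^ lev n \<le> 4 * (1 + (real_of_int n)\<^sup>2)"
proof (cases "lev n")
  case (Suc j)
  then have "2 ^ j < \<bar>n\<bar>" by (intro lev_gt) simp
  then have "real_of_int (2 ^ j) < real_of_int \<bar>n\<bar>" by (simp only: of_int_less_iff)
  then have "(2 ^ j)\<^sup>2 \<le> \<bar>real_of_int n\<bar>\<^sup>2" by (intro power_mono) simp_all
  then have "4 ^ j \<le> (real_of_int n)\<^sup>2" by (simp add: power2_eq_square flip: power_mult_distrib)
  then show ?thesis by (simp add: Suc)
qed simp

lemma sq_le_lev: "(real_of_int n)\<^sup>2 \<le> 4 ^ lev n"
proof -
  have "real_of_int \<bar>n\<bar> \<le> real_of_int (2 ^ lev n)"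
    using abs_le_lev by (simp only: of_int_le_iff)
  then have "\<bar>real_of_int n\<bar>\<^sup>2 \<le> (2 ^ lev n)\<^sup>2" by (intro power_mono) simp_all
  then show ?thesis by (simp add: power2_eq_square flip: power_mult_distrib)
qed

section \<open>Counting points of separated sets by level\<close>

definition separated :: "nat \<Rightarrow> (int ^ 'n::finite) set \<Rightarrow> bool" where
  "separated m X \<longleftrightarrow> (\<forall>i :: 'n \<Rightarrow> nat. sum i UNIV = m \<longrightarrow>
     (\<forall>k\<in>X. \<forall>l\<in>X. (\<forall>s. \<bar>k $ s - l $ s\<bar> < 2 ^ i s) \<longrightarrow> k = l))"

lemma ex_smaller_with_sum:
  fixes j :: "'n::finite \<Rightarrow> nat"
  assumes "m \<le> sum j UNIV"
  shows "\<exists>i. (\<forall>s. i s \<le> j s) \<and> sum i UNIV = m"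
  using assms
proof (induction m)
  case 0
  show ?case by (intro exI[of _ "\<lambda>_. 0"]) simp
next
  case (Suc m)
  then obtain i where i: "\<forall>s. i s \<le> j s" "sum i UNIV = m" by auto
  have "\<exists>s. i s < j s"
  proof (rule ccontr)
    assume "\<nexists>s. i s < j s"
    then have "sum j UNIV \<le> sum i UNIV" by (intro sum_mono) (simp add: not_less)
    with i Suc.prems show False by simp
  qed
  then obtain s where s: "i s < j s" ..
  have "sum (i(s := Suc (i s))) UNIV = Suc m"
    using i(2) by (simp add: sum.remove[of UNIV s] fun_upd_def)
  with i(1) s show ?case by (intro exI[of _ "i(s := Suc (i s))"]) auto
qed

lemma div_in_range:
  fixes k :: int
  assumes "\<bar>k\<bar> \<le> 2 ^ j" "i \<le> j"
  shows "k div 2 ^ i \<in> {- (2 ^ (j - i))..2 ^ (j - i)}"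
proof -
  have eq: "(2::int) ^ j = 2 ^ (j - i) * 2 ^ i" using assms(2) by (simp flip: power_add)
  have "k div 2 ^ i \<le> (2 ^ (j - i) * 2 ^ i) div 2 ^ i"
    using assms(1) by (intro zdiv_mono1) (auto simp flip: eq)
  moreover have "(- (2 ^ (j - i)) * 2 ^ i) div 2 ^ i \<le> k div 2 ^ i"
    using assms(1) by (intro zdiv_mono1) (auto simp flip: eq)
  ultimately show ?thesis by (simp only: atLeastAtMost_iff nonzero_mult_div_cancel_right power_not_zero zero_neq_numeral not_False_eq_True)
qed

lemma div_eq_imp_close:
  fixes k l :: int
  assumes "k div 2 ^ i = l div 2 ^ i"
  shows "\<bar>k - l\<bar> < 2 ^ i"
proof -
  have "k - l = k mod 2 ^ i - l mod 2 ^ i"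
    using assms by (simp add: minus_div_mult_eq_mod[symmetric])
  moreover have "0 \<le> k mod 2 ^ i" "k mod 2 ^ i < 2 ^ i" "0 \<le> l mod 2 ^ i" "l mod 2 ^ i < 2 ^ i"
    by simp_all
  ultimately show ?thesis by linarith
qed

text \<open>\<open>separated\<close> admits all box shapes of a given volume so that one can be
  chosen below the level vector \<open>j\<close>. Division by the side lengths then sends distinct
  points to distinct cells, and coordinate \<open>s\<close> meets at most
  \<open>2 * 2 ^ (j s - i s) + 1\<close> cells, which is where the 3 comes from.\<close>

lemma separated_card_le:
  fixes X :: "(int ^ 'n::finite) set" and j :: "'n \<Rightarrow> nat"
  assumes "separated m X" "m \<le> sum j UNIV"
  shows "card {k \<in> X. \<forall>s. lev (k $ s) = j s} \<le> 3 ^ CARD('n) * 2 ^ (sum j UNIV - m)"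
proof -
  obtain i where i: "\<And>s. i s \<le> j s" "sum i UNIV = m"
    using ex_smaller_with_sum[OF assms(2)] by auto
  let ?Y = "{k \<in> X. \<forall>s. lev (k $ s) = j s}"
  let ?B = "\<lambda>s. {- (2 ^ (j s - i s))..(2::int) ^ (j s - i s)}"
  define \<phi> where "\<phi> k = (\<lambda>s. (k $ s) div (2::int) ^ i s)" for k :: "int ^ 'n"
  have "inj_on \<phi> ?Y"
  proof (rule inj_onI)
    fix k l assume kl: "k \<in> ?Y" "l \<in> ?Y" "\<phi> k = \<phi> l"
    then have "\<bar>k $ s - l $ s\<bar> < 2 ^ i s" for s
      by (intro div_eq_imp_close) (simp add: \<phi>_def fun_eq_iff)
    with kl i(2) assms(1) show "k = l" unfolding separated_def by blast
  qed
  moreover have "\<phi> ` ?Y \<subseteq> PiE UNIV ?B"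
  proof (intro image_subsetI PiE_I)
    fix k s assume "k \<in> ?Y"
    then show "\<phi> k s \<in> ?B s"
      unfolding \<phi>_def using abs_le_lev[of "k $ s"] by (intro div_in_range i) auto
  qed auto
  ultimately have "card ?Y \<le> card (PiE UNIV ?B)"
    by (intro card_inj_on_le finite_PiE) auto
  also have "\<dots> = (\<Prod>s\<in>UNIV. card (?B s))"
    by (rule card_PiE) simp
  also have "\<dots> \<le> (\<Prod>s\<in>UNIV. 3 * 2 ^ (j s - i s))"
  proof (rule prod_mono, rule conjI)
    fix s
    have "card (?B s) = nat (2 * 2 ^ (j s - i s) + 1)" by simp
    also have "\<dots> \<le> nat (3 * 2 ^ (j s - i s))"
      by (intro nat_mono) simp
    finally show "card (?B s) \<le> 3 * 2 ^ (j s - i s)" by (simp add: nat_mult_distrib nat_power_eq)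
  qed simp
  also have "\<dots> = 3 ^ CARD('n) * 2 ^ (\<Sum>s\<in>UNIV. j s - i s)"
    by (simp add: prod.distrib power_sum)
  also have "(\<Sum>s\<in>UNIV. j s - i s) = sum j UNIV - m"
    using i by (simp add: sum_subtractf_nat)
  finally show ?thesis .
qed

lemma finite_functions_with_sum: "finite {j :: 'n::finite \<Rightarrow> nat. sum j UNIV = m}"
proof (rule finite_subset)
  show "{j :: 'n \<Rightarrow> nat. sum j UNIV = m} \<subseteq> PiE UNIV (\<lambda>_. {..m})"
    by (auto simp: PiE_def intro: member_le_sum)
  show "finite (PiE (UNIV :: 'n set) (\<lambda>_. {..m}))" by (intro finite_PiE) auto
qed

text \<open>The omitted coordinate is determined by the others and the total \<open>m\<close>, so
  the simplex embeds into a cube of dimension d - 1, over which the sum of products factors. For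
  \<open>x = 1\<close> this bounds the number of level vectors by (m + 1)^(d - 1).\<close>

lemma simplex_sum_le:
  fixes x :: real and s :: "'n::finite"
  assumes "x \<ge> 0"
  shows "(\<Sum>j\<in>{j :: 'n \<Rightarrow> nat. sum j UNIV = m}. \<Prod>t\<in>UNIV - {s}. x ^ j t) \<le> (\<Sum>i\<le>m. x ^ i) ^ (CARD('n) - 1)"
proof -
  let ?J = "{j :: 'n \<Rightarrow> nat. sum j UNIV = m}" and ?r = "\<lambda>j :: 'n \<Rightarrow> nat. restrict j (UNIV - {s})"
  have inj: "inj_on ?r ?J"
  proof (rule inj_onI)
    fix j j' :: "'n \<Rightarrow> nat" assume *: "j \<in> ?J" "j' \<in> ?J" "?r j = ?r j'"
    then have eq: "j t = j' t" if "t \<noteq> s" for t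
      using that by (metis DiffI UNIV_I restrict_apply' singletonD)
    have "sum j (UNIV - {s}) = sum j' (UNIV - {s})" by (rule sum.cong) (auto simp: eq)
    moreover have "j s + sum j (UNIV - {s}) = j' s + sum j' (UNIV - {s})"
      using * by (simp flip: sum.remove)
    ultimately have "j s = j' s" by simp
    with eq show "j = j'" by (metis ext)
  qed
  have "(\<Sum>j\<in>?J. \<Prod>t\<in>UNIV - {s}. x ^ j t) = (\<Sum>p\<in>?r ` ?J. \<Prod>t\<in>UNIV - {s}. x ^ p t)"
    by (subst sum.reindex[OF inj]) (auto intro!: sum.cong prod.cong)
  also have "\<dots> \<le> (\<Sum>p\<in>PiE (UNIV - {s}) (\<lambda>_. {..m}). \<Prod>t\<in>UNIV - {s}. x ^ p t)"
  proof (intro sum_mono2 finite_PiE prod_nonneg zero_le_power assms)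
    show "?r ` ?J \<subseteq> PiE (UNIV - {s}) (\<lambda>_. {..m})"
    proof (intro image_subsetI restrict_PiE_iff[THEN iffD2] ballI)
      fix j t assume "j \<in> ?J"
      then show "j t \<in> {..m}" using member_le_sum[of t UNIV j] by simp
    qed
  qed auto
  also have "\<dots> = (\<Prod>t\<in>UNIV - {s}. \<Sum>i\<le>m. x ^ i)"
    by (rule prod_sum_PiE[symmetric]) auto
  also have "\<dots> = (\<Sum>i\<le>m. x ^ i) ^ (CARD('n) - 1)"
    by (simp add: card_Diff_singleton)
  finally show ?thesis .
qed

text \<open>To be used with \<open>x = 4 powr \<beta>\<close> and
  \<open>y = 4 powr (- \<alpha>)\<close>. Points are grouped by level vector and level vectors by
  their total \<open>n\<close>; a single level vector holds at most 3^d * 2^(n - m) points.\<close>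

lemma sum_over_separated_le:
  fixes X :: "(int ^ 'n::finite) set" and x y :: real
  assumes X: "separated m X" "\<And>k. k \<in> X \<Longrightarrow> m \<le> total_lev k" and F: "finite F" "F \<subseteq> X"
    and x: "x > 0" and y: "y \<ge> 0"
  shows "\<exists>N. (\<Sum>k\<in>F. (1 / x) ^ lev (k $ s) * y ^ total_lev k)
    \<le> 3 ^ CARD('n) * (\<Sum>n=m..N. 2 ^ (n - m) * (y / x) ^ n * (\<Sum>i\<le>n. x ^ i) ^ (CARD('n) - 1))"
proof -
  define L where "L k = (\<lambda>t. lev (k $ t))" for k :: "int ^ 'n"
  define g where "g j = 3 ^ CARD('n) * 2 ^ (sum j UNIV - m) * ((1 / x) ^ j s * y ^ sum j UNIV)" for j :: "'n \<Rightarrow> nat"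
  have g_nonneg: "g j \<ge> 0" for j using x y by (simp add: g_def)
  have finL: "finite (L ` F)" using F by simp
  \<comment> \<open>\<open>N\<close> only has to dominate the totals occurring in the finite set
    \<open>F\<close>; inserting \<open>m\<close> covers an empty \<open>F\<close>.\<close>
  define N where "N = Max (insert m ((\<lambda>j. sum j UNIV) ` L ` F))"
  have N: "sum j UNIV \<in> {m..N}" if "j \<in> L ` F" for j
  proof -
    have "sum j UNIV \<le> N" unfolding N_def using that finL by (intro Max_ge) auto
    moreover have "m \<le> sum j UNIV" using that X(2) F(2) by (auto simp: L_def total_lev_def)
    ultimately show ?thesis by simp
  qed
  have "(\<Sum>k\<in>F. (1 / x) ^ lev (k $ s) * y ^ total_lev k)
      = (\<Sum>j\<in>L ` F. \<Sum>k\<in>{k \<in> F. L k = j}. (1 / x) ^ lev (k $ s) * y ^ total_lev k)"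
    by (rule sum.image_gen[OF F(1)])
  also have "\<dots> \<le> (\<Sum>j\<in>L ` F. g j)"
  proof (rule sum_mono)
    fix j assume j: "j \<in> L ` F"
    have "(\<Sum>k\<in>{k \<in> F. L k = j}. (1 / x) ^ lev (k $ s) * y ^ total_lev k)
        = (\<Sum>k\<in>{k \<in> F. L k = j}. (1 / x) ^ j s * y ^ sum j UNIV)"
      by (intro sum.cong refl) (auto simp: L_def total_lev_def)
    also have "\<dots> = real (card {k \<in> F. \<forall>t. lev (k $ t) = j t}) * ((1 / x) ^ j s * y ^ sum j UNIV)"
      by (simp add: L_def fun_eq_iff)
    also have "\<dots> \<le> g j"
      unfolding g_def
    proof (rule mult_right_mono)
      have "separated m F" using X(1) F(2) unfolding separated_def by blast
      from separated_card_le[OF this] N[OF j]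
      have "card {k \<in> F. \<forall>t. lev (k $ t) = j t} \<le> 3 ^ CARD('n) * 2 ^ (sum j UNIV - m)" by auto
      then have "real (card {k \<in> F. \<forall>t. lev (k $ t) = j t}) \<le> real (3 ^ CARD('n) * 2 ^ (sum j UNIV - m))"
        by (simp only: of_nat_le_iff)
      then show "real (card {k \<in> F. \<forall>t. lev (k $ t) = j t}) \<le> 3 ^ CARD('n) * 2 ^ (sum j UNIV - m)"
        by simp
    qed (use x y in auto)
    finally show "(\<Sum>k\<in>{k \<in> F. L k = j}. (1 / x) ^ lev (k $ s) * y ^ total_lev k) \<le> g j" .
  qed
  also have "\<dots> = (\<Sum>n=m..N. \<Sum>j\<in>{j \<in> L ` F. sum j UNIV = n}. g j)"
    by (rule sum.group[symmetric]) (use finL N in auto)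
  also have "\<dots> \<le> (\<Sum>n=m..N. \<Sum>j\<in>{j. sum j UNIV = n}. g j)"
    by (intro sum_mono sum_mono2 finite_functions_with_sum) (auto simp: g_nonneg)
  also have "\<dots> \<le> (\<Sum>n=m..N. 3 ^ CARD('n) * (2 ^ (n - m) * (y / x) ^ n * (\<Sum>i\<le>n. x ^ i) ^ (CARD('n) - 1)))"
  proof (rule sum_mono)
    fix n
    have "(\<Sum>j\<in>{j. sum j UNIV = n}. g j) =
        (\<Sum>j\<in>{j. sum j UNIV = n}. 3 ^ CARD('n) * 2 ^ (n - m) * (y / x) ^ n * (\<Prod>t\<in>UNIV - {s}. x ^ j t))"
    proof (intro sum.cong refl)
      fix j :: "'n \<Rightarrow> nat" assume "j \<in> {j. sum j UNIV = n}"
      then have n: "sum j UNIV = n" by simp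
      \<comment> \<open>Since the levels add up to \<open>n\<close>, the factor
        \<open>(1 / x) ^ j s\<close> equals \<open>(1 / x) ^ n\<close> times powers of
        \<open>x\<close> in the other coordinates, the form that \<open>simplex_sum_le\<close>
        sums.\<close>
      have "x ^ n = x ^ j s * (\<Prod>t\<in>UNIV - {s}. x ^ j t)"
        unfolding n[symmetric] power_sum by (rule prod.remove) auto
      then have "(1 / x) ^ j s = (\<Prod>t\<in>UNIV - {s}. x ^ j t) / x ^ n"
        using x by (simp add: field_simps)
      then show "g j = 3 ^ CARD('n) * 2 ^ (n - m) * (y / x) ^ n * (\<Prod>t\<in>UNIV - {s}. x ^ j t)"
        unfolding g_def n by (simp add: power_divide)
    qed
    also have "\<dots> = 3 ^ CARD('n) * 2 ^ (n - m) * (y / x) ^ n * (\<Sum>j\<in>{j. sum j UNIV = n}. \<Prod>t\<in>UNIV - {s}. x ^ j t)"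
      by (rule sum_distrib_left[symmetric])
    also have "\<dots> \<le> 3 ^ CARD('n) * 2 ^ (n - m) * (y / x) ^ n * (\<Sum>i\<le>n. x ^ i) ^ (CARD('n) - 1)"
      using x y by (intro mult_left_mono simplex_sum_le) auto
    finally show "(\<Sum>j\<in>{j. sum j UNIV = n}. g j) \<le> 3 ^ CARD('n) * (2 ^ (n - m) * (y / x) ^ n * (\<Sum>i\<le>n. x ^ i) ^ (CARD('n) - 1))"
      by (simp add: mult_ac)
  qed
  finally show ?thesis by (intro exI[of _ N]) (simp add: sum_distrib_left)
qed

section \<open>Geometric series with polynomial factors\<close>

lemma summable_poly_geometric:
  fixes r :: real
  assumes "0 \<le> r" "r < 1"
  shows "summable (\<lambda>l. r ^ l * real (l + 1) ^ q)"
proof (cases "r = 0")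
  case True
  have "(\<lambda>l. r ^ l * real (l + 1) ^ q) = (\<lambda>l. if l = 0 then 1 else 0)"
    by (auto simp: True fun_eq_iff)
  then show ?thesis by simp
next
  case False
  then have r: "0 < r" using assms by simp
  \<comment> \<open>Half of the decay, \<open>p ^ l\<close>, absorbs the polynomial; the other half
    is summable.\<close>
  define p where "p = sqrt r"
  have p: "0 < p" "p < 1" "r = p * p" using r assms by (auto simp: p_def)
  have "(\<lambda>l. p ^ l * real (l + 1) ^ q) \<longlonglongrightarrow> 0"
    using p by real_asymp
  then have "\<forall>\<^sub>F l in sequentially. p ^ l * real (l + 1) ^ q < 1"
    by (rule order_tendstoD) simp
  then have "\<forall>\<^sub>F l in sequentially. norm (r ^ l * real (l + 1) ^ q) \<le> p ^ l"
  proof eventually_elim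
    case (elim l)
    have "r ^ l * real (l + 1) ^ q = p ^ l * (p ^ l * real (l + 1) ^ q)"
      by (simp add: p power_mult_distrib mult_ac)
    also have "\<dots> \<le> p ^ l * 1"
      using elim p by (intro mult_left_mono) auto
    finally show ?case using assms by simp
  qed
  then show ?thesis
    by (rule summable_comparison_test_ev) (use p in \<open>simp add: summable_geometric\<close>)
qed

text \<open>Source of the case distinction in the theorem: for \<open>x = 4 powr \<beta>\<close>,
  the value 1 means \<open>\<beta> = 0\<close>, and only then do the partial sums grow.\<close>

lemma geometric_partial_sum_le:
  fixes x :: real
  assumes "0 < x" "x \<le> 1"
  shows "\<exists>C>0. \<forall>n. (\<Sum>i\<le>n. x ^ i) ^ e \<le> C * real (n + 1) ^ (if x = 1 then e else 0)"
proof (cases "x = 1")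
  case True
  then show ?thesis by (intro exI[of _ 1]) auto
next
  case False
  have "(\<Sum>i\<le>n. x ^ i) \<le> 1 / (1 - x)" for n
  proof -
    have "(\<Sum>i\<le>n. x ^ i) \<le> (\<Sum>i. x ^ i)"
      using assms False by (intro sum_le_suminf summable_geometric) auto
    then show ?thesis using assms False by (simp add: suminf_geometric)
  qed
  then have "(\<Sum>i\<le>n. x ^ i) ^ e \<le> (1 / (1 - x)) ^ e" for n
    using assms by (intro power_mono sum_nonneg) auto
  then show ?thesis using False assms by (intro exI[of _ "(1 / (1 - x)) ^ e"]) auto
qed

lemma geometric_tail_le:
  fixes r :: real
  assumes r: "0 \<le> r" "r < 1"
  shows "\<exists>C>0. \<forall>m N. (\<Sum>n=m..N. r ^ n * real (n + 1) ^ q) \<le> C * (r ^ m * real (m + 1) ^ q)"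
proof -
  define C where "C = (\<Sum>l. r ^ l * real (l + 1) ^ q) + 1"
  have sm: "summable (\<lambda>l. r ^ l * real (l + 1) ^ q)" by (rule summable_poly_geometric[OF r])
  have nn: "0 \<le> r ^ l * real (l + 1) ^ q" for l using r by simp
  have "0 \<le> (\<Sum>l. r ^ l * real (l + 1) ^ q)" by (rule suminf_nonneg[OF sm nn])
  then have "C > 0" by (simp add: C_def)
  moreover have "(\<Sum>n=m..N. r ^ n * real (n + 1) ^ q) \<le> C * (r ^ m * real (m + 1) ^ q)" for m N
  proof -
    have "(\<Sum>n=m..N. r ^ n * real (n + 1) ^ q) = (\<Sum>l\<in>(\<lambda>n. n - m) ` {m..N}. r ^ (l + m) * real (l + m + 1) ^ q)"
      by (subst sum.reindex) (auto simp: inj_on_def intro!: sum.cong)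
    also have "\<dots> \<le> (\<Sum>l\<in>(\<lambda>n. n - m) ` {m..N}. r ^ m * real (m + 1) ^ q * (r ^ l * real (l + 1) ^ q))"
    proof (rule sum_mono)
      fix l
      \<comment> \<open>Submultiplicativity of the polynomial factor lets the first term of the tail
        be pulled out, so that \<open>C\<close> depends on neither \<open>m\<close> nor
        \<open>N\<close>.\<close>
      have "real (l + m + 1) \<le> real (m + 1) * real (l + 1)"
        by (simp add: algebra_simps)
      then have "real (l + m + 1) ^ q \<le> real (m + 1) ^ q * real (l + 1) ^ q"
        unfolding power_mult_distrib[symmetric] by (intro power_mono) auto
      then have "r ^ (l + m) * real (l + m + 1) ^ q \<le> r ^ (l + m) * (real (m + 1) ^ q * real (l + 1) ^ q)"
        using r by (intro mult_left_mono) auto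
      then show "r ^ (l + m) * real (l + m + 1) ^ q \<le> r ^ m * real (m + 1) ^ q * (r ^ l * real (l + 1) ^ q)"
        by (simp only: power_add mult_ac)
    qed
    also have "\<dots> = r ^ m * real (m + 1) ^ q * (\<Sum>l\<in>(\<lambda>n. n - m) ` {m..N}. r ^ l * real (l + 1) ^ q)"
      by (rule sum_distrib_left[symmetric])
    also have "\<dots> \<le> r ^ m * real (m + 1) ^ q * C"
    proof (rule mult_left_mono)
      have "(\<Sum>l\<in>(\<lambda>n. n - m) ` {m..N}. r ^ l * real (l + 1) ^ q) \<le> (\<Sum>l. r ^ l * real (l + 1) ^ q)"
        by (rule sum_le_suminf[OF sm]) (simp, rule nn)
      then show "(\<Sum>l\<in>(\<lambda>n. n - m) ` {m..N}. r ^ l * real (l + 1) ^ q) \<le> C" by (simp add: C_def)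
    qed (use r in auto)
    finally show ?thesis by (simp add: mult.commute)
  qed
  ultimately show ?thesis by blast
qed

section \<open>Weights in terms of levels\<close>

lemma one_plus_norm_sq_le_lev:
  fixes k :: "int ^ 'n::finite"
  assumes "\<And>s. lev (k $ s) \<le> N"
  shows "1 + (\<Sum>s\<in>UNIV. (real_of_int (k $ s))\<^sup>2) \<le> (1 + real CARD('n)) * 4 ^ N"
proof -
  have "(\<Sum>s\<in>UNIV. (real_of_int (k $ s))\<^sup>2) \<le> (\<Sum>s\<in>(UNIV :: 'n set). 4 ^ N)"
  proof (rule sum_mono)
    fix s
    have "(4::real) ^ lev (k $ s) \<le> 4 ^ N" using assms by (intro power_increasing) auto
    with sq_le_lev[of "k $ s"] show "(real_of_int (k $ s))\<^sup>2 \<le> 4 ^ N" by linarith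
  qed
  moreover have "(1::real) \<le> 4 ^ N" by (rule one_le_power) simp
  ultimately show ?thesis by (simp add: ring_distribs del: one_le_power)
qed

lemma prod_weight_ge_total_lev:
  fixes k :: "int ^ 'n::finite"
  shows "4 ^ total_lev k \<le> 4 ^ CARD('n) * (\<Prod>s\<in>UNIV. 1 + (real_of_int (k $ s))\<^sup>2)"
proof -
  have "(4::real) ^ total_lev k = (\<Prod>s\<in>UNIV. 4 ^ lev (k $ s))"
    by (simp add: total_lev_def power_sum)
  also have "\<dots> \<le> (\<Prod>s\<in>UNIV. 4 * (1 + (real_of_int (k $ s))\<^sup>2))"
    by (intro prod_mono conjI one_plus_sq_ge_lev) simp
  also have "\<dots> = 4 ^ CARD('n) * (\<Prod>s\<in>UNIV. 1 + (real_of_int (k $ s))\<^sup>2)"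
    by (simp only: prod.distrib prod_constant)
  finally show ?thesis .
qed

lemma one_plus_sq_pos: "0 < 1 + (real_of_int n)\<^sup>2"
  by (intro add_pos_nonneg) auto

lemma one_plus_norm_sq_ge_1: "1 \<le> 1 + (\<Sum>s\<in>UNIV. (real_of_int (k $ s))\<^sup>2)"
  by (simp add: sum_nonneg)

lemma prod_one_plus_sq_ge_1: "1 \<le> (\<Prod>s\<in>UNIV. 1 + (real_of_int (k $ s))\<^sup>2)"
  by (rule prod_ge_1) simp

lemma hybrid_weight_alt:
  "hybrid_weight \<alpha> \<beta> k = (1 + (\<Sum>s\<in>UNIV. (real_of_int (k $ s))\<^sup>2)) powr \<beta> *
     (\<Prod>s\<in>UNIV. 1 + (real_of_int (k $ s))\<^sup>2) powr \<alpha>"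
  unfolding hybrid_weight_def by (subst prod_powr_distrib) (auto simp: less_imp_le one_plus_sq_pos)

lemma hybrid_weight_pos: "hybrid_weight \<alpha> \<beta> k > 0"
proof -
  have "0 < 1 + (\<Sum>s\<in>UNIV. (real_of_int (k $ s))\<^sup>2)" "0 < (\<Prod>s\<in>UNIV. 1 + (real_of_int (k $ s))\<^sup>2)"
    using one_plus_norm_sq_ge_1[of k] prod_one_plus_sq_ge_1[of k] by linarith+
  then show ?thesis unfolding hybrid_weight_alt by (metis mult_pos_pos powr_gt_zero less_irrefl)
qed

lemma four_powr_power: "(4 ^ n) powr a = (4 powr a) ^ n" for a :: real
  by (simp add: powr_power flip: powr_realpow) (simp add: powr_powr mult.commute)

text \<open>The sum over \<open>s\<close> replaces the maximal level, which governs the isotropic part of the weight.\<close>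

lemma inverse_weight_le:
  fixes k :: "int ^ 'n::finite"
  assumes "\<beta> \<le> 0" "\<alpha> \<ge> 0"
  shows "1 / hybrid_weight \<alpha> \<beta> k \<le> (1 + real CARD('n)) powr (- \<beta>) * (4 powr \<alpha>) ^ CARD('n) *
     (\<Sum>s\<in>UNIV. (1 / 4 powr \<beta>) ^ lev (k $ s) * (4 powr (- \<alpha>)) ^ total_lev k)"
proof -
  let ?S = "1 + (\<Sum>s\<in>UNIV. (real_of_int (k $ s))\<^sup>2)" and ?P = "\<Prod>s\<in>UNIV. 1 + (real_of_int (k $ s))\<^sup>2"
  have S: "?S \<ge> 1" and P: "?P \<ge> 1"
    by (rule one_plus_norm_sq_ge_1, rule prod_one_plus_sq_ge_1)
  have "finite (range (\<lambda>s. lev (k $ s)))" by simp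
  then have "Max (range (\<lambda>s. lev (k $ s))) \<in> range (\<lambda>s. lev (k $ s))" by (intro Max_in) auto
  then obtain s0 where "Max (range (\<lambda>s. lev (k $ s))) = lev (k $ s0)" by (rule imageE)
  then have s0: "lev (k $ s) \<le> lev (k $ s0)" for s
    using Max_ge[of "range (\<lambda>s. lev (k $ s))" "lev (k $ s)"] by simp
  have "?S powr (- \<beta>) \<le> ((1 + real CARD('n)) * 4 ^ lev (k $ s0)) powr (- \<beta>)"
    using S assms one_plus_norm_sq_le_lev[of k, OF s0] by (intro powr_mono2) auto
  also have "\<dots> = (1 + real CARD('n)) powr (- \<beta>) * (1 / 4 powr \<beta>) ^ lev (k $ s0)"
    by (simp add: powr_mult four_powr_power powr_minus_divide power_one_over)
  also have "\<dots> \<le> (1 + real CARD('n)) powr (- \<beta>) * (\<Sum>s\<in>UNIV. (1 / 4 powr \<beta>) ^ lev (k $ s))"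
    by (intro mult_left_mono member_le_sum) auto
  finally have 1: "?S powr (- \<beta>) \<le> (1 + real CARD('n)) powr (- \<beta>) * (\<Sum>s\<in>UNIV. (1 / 4 powr \<beta>) ^ lev (k $ s))" .
  have "?P powr (- \<alpha>) = (4 powr \<alpha>) ^ CARD('n) * (4 ^ CARD('n) * ?P) powr (- \<alpha>)"
    using P by (simp add: powr_mult four_powr_power powr_minus power_inverse)
  also have "\<dots> \<le> (4 powr \<alpha>) ^ CARD('n) * (4 ^ total_lev k) powr (- \<alpha>)"
    using prod_weight_ge_total_lev[of k] assms by (intro mult_left_mono powr_mono2') auto
  also have "(4 ^ total_lev k) powr (- \<alpha>) = (4 powr (- \<alpha>)) ^ total_lev k"
    by (rule four_powr_power)
  finally have 2: "?P powr (- \<alpha>) \<le> (4 powr \<alpha>) ^ CARD('n) * (4 powr (- \<alpha>)) ^ total_lev k" .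
  have "1 / hybrid_weight \<alpha> \<beta> k = ?S powr (- \<beta>) * ?P powr (- \<alpha>)"
    by (simp add: hybrid_weight_alt powr_minus divide_simps)
  also have "\<dots> \<le> ((1 + real CARD('n)) powr (- \<beta>) * (\<Sum>s\<in>UNIV. (1 / 4 powr \<beta>) ^ lev (k $ s))) *
     ((4 powr \<alpha>) ^ CARD('n) * (4 powr (- \<alpha>)) ^ total_lev k)"
    by (intro mult_mono 1 2 mult_nonneg_nonneg sum_nonneg) auto
  finally show ?thesis unfolding sum_distrib_right[symmetric] by (simp only: mult_ac)
qed

text \<open>Each further total level doubles the bound on the points per level vector and multiplies
  the weight bound by \<open>4 powr (- (\<alpha> + \<beta>))\<close>. The sum over totals is
  therefore geometric of ratio \<open>r < 1\<close>, up to a polynomial factor, and its first term,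
  at \<open>m\<close>, dominates.\<close>

lemma inverse_weight_sum_le:
  fixes \<alpha> \<beta> :: real
  assumes "\<beta> \<le> 0" "\<alpha> + \<beta> > 1/2"
  shows "\<exists>C>0. \<forall>m (X :: (int ^ 'n::finite) set) F. separated m X \<longrightarrow> (\<forall>k\<in>X. m \<le> total_lev k) \<longrightarrow>
     finite F \<longrightarrow> F \<subseteq> X \<longrightarrow>
     (\<Sum>k\<in>F. 1 / hybrid_weight \<alpha> \<beta> k) \<le>
       C * (real (m + 1) ^ (if \<beta> = 0 then CARD('n) - 1 else 0) * 4 powr (- (\<alpha> + \<beta>) * real m))"
proof -
  define x y :: real where "x = 4 powr \<beta>" and "y = 4 powr (- \<alpha>)"
  define q where "q = (if \<beta> = 0 then CARD('n) - 1 else 0)"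
  define r where "r = 2 * (y / x)"
  have x: "0 < x" "x \<le> 1"
    using powr_mono[of \<beta> 0 4] assms(1) by (auto simp: x_def)
  have x1: "x = 1 \<longleftrightarrow> \<beta> = 0"
    by (simp add: x_def)
  have y: "0 < y" by (simp add: y_def)
  have yx: "y / x = 4 powr (- (\<alpha> + \<beta>))"
    by (simp add: x_def y_def powr_diff[symmetric])
  have "(4::real) powr (- (\<alpha> + \<beta>)) < 4 powr (- (1/2))"
    using assms(2) by (intro powr_less_mono) auto
  also have "(4::real) powr (- (1/2)) = 1 / 2"
    by (simp add: powr_minus_divide powr_half_sqrt)
  finally have r: "0 \<le> r" "r < 1" using x y yx by (auto simp: r_def)
  obtain C1 where C1: "C1 > 0" "\<And>n. (\<Sum>i\<le>n. x ^ i) ^ (CARD('n) - 1) \<le> C1 * real (n + 1) ^ q"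
    using geometric_partial_sum_le[OF x, of "CARD('n) - 1"] x1 by (auto simp: q_def)
  obtain C2 where C2: "C2 > 0" "\<And>m N. (\<Sum>n=m..N. r ^ n * real (n + 1) ^ q) \<le> C2 * (r ^ m * real (m + 1) ^ q)"
    using geometric_tail_le[OF r, of q] by blast
  define C0 where "C0 = (1 + real CARD('n)) powr (- \<beta>) * (4 powr \<alpha>) ^ CARD('n)"
  have C0: "C0 > 0" by (simp add: C0_def)
  define C where "C = C0 * (real CARD('n) * (3 ^ CARD('n) * (C1 * C2)))"
  have "(\<Sum>k\<in>F. 1 / hybrid_weight \<alpha> \<beta> k) \<le> C * (real (m + 1) ^ q * 4 powr (- (\<alpha> + \<beta>) * real m))"
    if X: "separated m X" "\<forall>k\<in>X. m \<le> total_lev k" and F: "finite F" "F \<subseteq> X" for m and X F :: "(int ^ 'n) set"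
  proof -
    have s_sum: "(\<Sum>k\<in>F. (1 / x) ^ lev (k $ s) * y ^ total_lev k)
        \<le> 3 ^ CARD('n) * (C1 * (C2 * ((y / x) ^ m * real (m + 1) ^ q)))" for s
    proof -
      obtain N where "(\<Sum>k\<in>F. (1 / x) ^ lev (k $ s) * y ^ total_lev k)
        \<le> 3 ^ CARD('n) * (\<Sum>n=m..N. 2 ^ (n - m) * (y / x) ^ n * (\<Sum>i\<le>n. x ^ i) ^ (CARD('n) - 1))"
        using sum_over_separated_le[OF X(1) bspec[OF X(2)] F x(1) less_imp_le[OF y]] by blast
      \<comment> \<open>\<open>2 ^ (n - m)\<close> is split: \<open>2 ^ n\<close> goes into
        \<open>r ^ n\<close>, while \<open>1 / 2 ^ m\<close> stays outside and later cancels the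
        \<open>2 ^ m\<close> contained in \<open>r ^ m\<close>.\<close>
      also have "\<dots> \<le> 3 ^ CARD('n) * (\<Sum>n=m..N. C1 / 2 ^ m * (r ^ n * real (n + 1) ^ q))"
      proof (intro mult_left_mono sum_mono)
        fix n assume n: "n \<in> {m..N}"
        have "2 ^ (n - m) * (y / x) ^ n * (\<Sum>i\<le>n. x ^ i) ^ (CARD('n) - 1) \<le> 2 ^ (n - m) * (y / x) ^ n * (C1 * real (n + 1) ^ q)"
          using x y by (intro mult_left_mono C1) auto
        also have "\<dots> = 2 ^ n / 2 ^ m * (y / x) ^ n * (C1 * real (n + 1) ^ q)"
          using n by (simp add: power_diff)
        also have "\<dots> = C1 / 2 ^ m * (r ^ n * real (n + 1) ^ q)"
          by (simp add: r_def power_mult_distrib power_divide)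
        finally show "2 ^ (n - m) * (y / x) ^ n * (\<Sum>i\<le>n. x ^ i) ^ (CARD('n) - 1) \<le> C1 / 2 ^ m * (r ^ n * real (n + 1) ^ q)" .
      qed simp
      also have "\<dots> = 3 ^ CARD('n) * (C1 / 2 ^ m * (\<Sum>n=m..N. r ^ n * real (n + 1) ^ q))"
        by (simp only: sum_distrib_left[symmetric])
      also have "\<dots> \<le> 3 ^ CARD('n) * (C1 / 2 ^ m * (C2 * (r ^ m * real (m + 1) ^ q)))"
        using C1(1) by (intro mult_left_mono C2) auto
      also have "\<dots> = 3 ^ CARD('n) * (C1 * (C2 * ((y / x) ^ m * real (m + 1) ^ q)))"
        by (simp add: r_def power_mult_distrib power_divide)
      finally show ?thesis .
    qed
    have "(\<Sum>k\<in>F. 1 / hybrid_weight \<alpha> \<beta> k) \<le> (\<Sum>k\<in>F. C0 * (\<Sum>s\<in>UNIV. (1 / x) ^ lev (k $ s) * y ^ total_lev k))"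
      unfolding C0_def x_def y_def by (rule sum_mono) (rule inverse_weight_le, use assms in auto)
    also have "\<dots> = C0 * (\<Sum>s\<in>UNIV. \<Sum>k\<in>F. (1 / x) ^ lev (k $ s) * y ^ total_lev k)"
      unfolding sum_distrib_left[symmetric] by (subst sum.swap) (rule refl)
    also have "\<dots> \<le> C0 * (\<Sum>s\<in>(UNIV :: 'n set). 3 ^ CARD('n) * (C1 * (C2 * ((y / x) ^ m * real (m + 1) ^ q))))"
      using C0 by (intro mult_left_mono sum_mono s_sum) auto
    also have "\<dots> = C * (real (m + 1) ^ q * (y / x) ^ m)"
      by (simp add: C_def mult_ac)
    also have "(y / x) ^ m = 4 powr (- (\<alpha> + \<beta>) * real m)"
      unfolding yx by (simp add: powr_power mult.commute)
    finally show ?thesis .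
  qed
  moreover have "C > 0" using C0 C1 C2 by (simp add: C_def)
  ultimately show ?thesis unfolding q_def by blast
qed

section \<open>Aliasing along rank-1 lattices\<close>

definition int_dot :: "int ^ 'n::finite \<Rightarrow> int ^ 'n \<Rightarrow> int" where
  "int_dot k z = (\<Sum>s\<in>UNIV. k $ s * z $ s)"

lemma int_dot_diff: "int_dot (k - l) z = int_dot k z - int_dot l z"
  by (simp add: int_dot_def left_diff_distrib sum_subtractf)

lemma fourier_exp_lattice_node:
  "fourier_exp k (lattice_node z M j) = cis (2 * pi * of_int (int_dot k z) / real M) ^ j"
proof -
  have "freq_dot k (lattice_node z M j) = real j * (of_int (int_dot k z) / real M)"
    by (simp add: freq_dot_def lattice_node_def int_dot_def sum_distrib_left sum_divide_distrib mult_ac)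
  then show ?thesis
    unfolding fourier_exp_cis Complex.DeMoivre by (intro arg_cong[of _ _ cis]) simp
qed

lemma cis_eq_1_iff_dvd:
  assumes "M \<ge> 1"
  shows "cis (2 * pi * of_int a / real M) = 1 \<longleftrightarrow> int M dvd a"
proof
  assume "int M dvd a"
  then obtain n where "a = int M * n" ..
  then have "2 * pi * of_int a / real M = 2 * pi * of_int n" using assms by simp
  then show "cis (2 * pi * of_int a / real M) = 1" by (simp only: cis_multiple_2pi Ints_of_int)
next
  assume "cis (2 * pi * of_int a / real M) = 1"
  then have "cos (2 * pi * of_int a / real M) = 1" by (simp add: complex_eq_iff)
  then obtain n :: int where "2 * pi * of_int a / real M = of_int n * 2 * pi"
    by (auto simp: cos_one_2pi_int)
  then have "real_of_int a = real_of_int (int M * n)" using assms by (simp add: field_simps)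
  then have "a = int M * n" by (simp only: of_int_eq_iff)
  then show "int M dvd a" by simp
qed

lemma fourier_exp_lattice_node_eq_1:
  assumes "M \<ge> 1" "int M dvd int_dot k z"
  shows "fourier_exp k (lattice_node z M j) = 1"
  using assms by (simp add: fourier_exp_lattice_node cis_eq_1_iff_dvd[THEN iffD2])

text \<open>For \<open>k\<close> outside the dual lattice the values at the nodes are the powers of
  an \<open>M\<close>-th root of unity other than 1, whose sum over \<open>j < M\<close>
  vanishes.\<close>

lemma fourier_exp_lattice_mean:
  assumes "M \<ge> 1"
  shows "1 / of_nat M * (\<Sum>j<M. fourier_exp k (lattice_node z M j)) = (if int M dvd int_dot k z then 1 else 0)"
proof (cases "int M dvd int_dot k z")
  case True
  then show ?thesis using assms by (simp add: fourier_exp_lattice_node_eq_1)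
next
  case False
  let ?w = "cis (2 * pi * of_int (int_dot k z) / real M)"
  have w: "?w \<noteq> 1" using False cis_eq_1_iff_dvd[OF assms] by simp
  have "?w ^ M = cis (2 * pi * of_int (int_dot k z))"
    unfolding Complex.DeMoivre using assms by (intro arg_cong[of _ _ cis]) simp
  then have "?w ^ M = 1" by (simp only: cis_multiple_2pi Ints_of_int)
  then have "(\<Sum>j<M. ?w ^ j) = 0" using w by (simp add: sum_gp_strict)
  then show ?thesis using False by (simp add: fourier_exp_lattice_node)
qed

lemma has_sum_sum:
  fixes f :: "'i \<Rightarrow> 'a \<Rightarrow> 'b::topological_comm_monoid_add"
  assumes "finite I" "\<And>i. i \<in> I \<Longrightarrow> (f i has_sum s i) A"
  shows "((\<lambda>x. \<Sum>i\<in>I. f i x) has_sum (\<Sum>i\<in>I. s i)) A"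
  using assms by (induction I rule: finite_induct) (auto intro: has_sum_add)

text \<open>The node mean is a finite sum, so it may be taken termwise in the series; there it keeps
  the frequencies congruent to \<open>k\<close> modulo the dual lattice and removes all
  others.\<close>

lemma lattice_coeff_aliasing:
  assumes M: "M \<ge> 1" and f: "\<And>x. ((\<lambda>l. c l * fourier_exp l x) has_sum f x) UNIV"
  shows "(c has_sum lattice_coeff z M f k) {l. int M dvd int_dot (l - k) z}"
proof -
  let ?x = "lattice_node z M"
  have "((\<lambda>l. c l * fourier_exp l (?x j) * fourier_exp (- k) (?x j)) has_sum f (?x j) * fourier_exp (- k) (?x j)) UNIV" for j
    by (rule has_sum_cmult_left[OF f])
  then have "((\<lambda>l. 1 / of_nat M * (\<Sum>j<M. c l * fourier_exp l (?x j) * fourier_exp (- k) (?x j))) has_sum lattice_coeff z M f k) UNIV"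
    unfolding lattice_coeff_def by (intro has_sum_cmult_right has_sum_sum) auto
  also have "(\<lambda>l. 1 / of_nat M * (\<Sum>j<M. c l * fourier_exp l (?x j) * fourier_exp (- k) (?x j)))
      = (\<lambda>l. c l * (if int M dvd int_dot (l - k) z then 1 else 0))"
  proof
    fix l
    have "c l * fourier_exp l (?x j) * fourier_exp (- k) (?x j) = c l * fourier_exp (l - k) (?x j)" for j
      using fourier_exp_add[of l "- k" "?x j"] by simp
    then have "1 / of_nat M * (\<Sum>j<M. c l * fourier_exp l (?x j) * fourier_exp (- k) (?x j))
        = c l * (1 / of_nat M * (\<Sum>j<M. fourier_exp (l - k) (?x j)))"
      by (simp only: sum_distrib_left[symmetric] mult.left_commute)
    then show "1 / of_nat M * (\<Sum>j<M. c l * fourier_exp l (?x j) * fourier_exp (- k) (?x j))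
        = c l * (if int M dvd int_dot (l - k) z then 1 else 0)"
      by (simp only: fourier_exp_lattice_mean[OF M])
  qed
  finally have "((\<lambda>l. c l * (if int M dvd int_dot (l - k) z then 1 else 0)) has_sum lattice_coeff z M f k) UNIV" .
  then show ?thesis
    by (rule has_sum_cong_neutral[THEN iffD1, rotated -1]) auto
qed

text \<open>For distinct \<open>k\<close> and \<open>l\<close>, a multiple of the difference of two
  exponentials, in the shape of a trigonometric sum. If \<open>k\<close> and \<open>l\<close> alias,
  it vanishes at all nodes; it both witnesses a failure of reconstruction and serves as the test
  function of the lower bound.\<close>

definition exp_diff :: "complex \<Rightarrow> int ^ 'n::finite \<Rightarrow> int ^ 'n \<Rightarrow> real ^ 'n \<Rightarrow> complex" where
  "exp_diff a k l x = (\<Sum>h\<in>{k, l}. (if h = k then a else - a) * fourier_exp h x)"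

lemma fourier_coeff_exp_diff:
  "fourier_coeff (exp_diff a k l) h = (if h = k then a else if h = l then - a else 0)"
  unfolding exp_diff_def[abs_def] by (subst fourier_coeff_trig_sum) auto

lemma sampling_exp_diff:
  assumes "M \<ge> 1" "int M dvd int_dot (k - l) z" "k \<noteq> l"
  shows "sampling_op I z M (exp_diff a k l) = (\<lambda>x. 0)"
proof -
  have "fourier_exp k (lattice_node z M j) = fourier_exp l (lattice_node z M j)" for j
    using fourier_exp_lattice_node_eq_1[OF assms(1,2), of j] fourier_exp_add[of "k - l" l "lattice_node z M j"] by simp
  then have "exp_diff a k l (lattice_node z M j) = 0" for j
    using assms(3) by (simp add: exp_diff_def)
  then have "lattice_coeff z M (exp_diff a k l) h = 0" for h
    by (simp add: lattice_coeff_def)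
  then show ?thesis by (simp add: sampling_op_def)
qed

text \<open>Two aliasing frequencies in \<open>I\<close> would give a nonzero trigonometric
  polynomial over \<open>I\<close> that the sampling operator maps to 0.\<close>

lemma reconstructing_lattice_distinct:
  fixes z :: "int ^ 'n::finite"
  assumes "reconstructing_lattice I z M" "finite I" "k \<in> I" "l \<in> I" "int M dvd int_dot (k - l) z"
  shows "k = l"
proof (rule ccontr)
  assume "k \<noteq> l"
  have M: "M \<ge> 1" using assms(1) by (simp add: reconstructing_lattice_def)
  define c :: "int ^ 'n \<Rightarrow> complex" where "c h = (if h = k then 1 else if h = l then -1 else 0)" for h
  have "exp_diff 1 k l x = (\<Sum>h\<in>I. c h * fourier_exp h x)" for x
    unfolding exp_diff_def using assms(2-4)
    by (intro sum.mono_neutral_cong_left) (auto simp: c_def)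
  then have "exp_diff 1 k l = (\<lambda>x. \<Sum>h\<in>I. c h * fourier_exp h x)" by (rule ext)
  then have "exp_diff 1 k l \<in> trig_polys I" unfolding trig_polys_def by blast
  then have "sampling_op I z M (exp_diff 1 k l) = exp_diff 1 k l"
    using assms(1) by (simp add: reconstructing_lattice_def)
  then have "exp_diff 1 k l = (\<lambda>x. 0)"
    by (simp only: sampling_exp_diff[OF M assms(5) \<open>k \<noteq> l\<close>])
  then have "fourier_coeff (exp_diff 1 k l) k = 0" by (simp add: fourier_coeff_def)
  then show False by (simp add: fourier_coeff_exp_diff)
qed

section \<open>Cosets of the dual lattice and the cross\<close>

lemma finite_hyperbolic_cross:
  assumes "R \<ge> 1"
  shows "finite (hyperbolic_cross R :: (int ^ 'n::finite) set)"
proof -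
  let ?n = "cross_radius R CARD('n)"
  have "k \<in> vec_lambda ` PiE UNIV (\<lambda>_. {- (2 ^ ?n)..2 ^ ?n})" if "k \<in> hyperbolic_cross R" for k :: "int ^ 'n"
  proof
    show "k = vec_lambda (($) k)" by simp
    have "\<bar>k $ s\<bar> \<le> 2 ^ ?n" for s
    proof -
      have "lev (k $ s) \<le> total_lev k" unfolding total_lev_def by (rule member_le_sum) auto
      then have "(2::int) ^ lev (k $ s) \<le> 2 ^ ?n"
        using that hyperbolic_cross_iff[OF assms, of k] by (intro power_increasing) auto
      with abs_le_lev[of "k $ s"] show ?thesis by linarith
    qed
    then show "($) k \<in> PiE UNIV (\<lambda>_. {- (2 ^ ?n)..2 ^ ?n})" by (auto simp: abs_le_iff minus_le_iff)
  qed
  then have "hyperbolic_cross R \<subseteq> (vec_lambda ` PiE UNIV (\<lambda>_. {- (2 ^ ?n)..2 ^ ?n}) :: (int ^ 'n) set)"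
    by blast
  then show ?thesis
    by (rule finite_subset) (intro finite_imageI finite_PiE, auto)
qed

text \<open>The coset of \<open>k\<close> modulo the dual lattice, punctured because the term at
  \<open>k\<close> is the true coefficient and cancels in the error.\<close>

definition alias_set :: "int ^ 'n::finite \<Rightarrow> nat \<Rightarrow> int ^ 'n \<Rightarrow> (int ^ 'n) set" where
  "alias_set z M k = {l. l \<noteq> k \<and> int M dvd int_dot (l - k) z}"

lemma alias_set_dvd:
  assumes "l \<in> alias_set z M k" "l' \<in> alias_set z M k"
  shows "int M dvd int_dot (l - l') z"
proof -
  have "int_dot (l - l') z = int_dot (l - k) z - int_dot (l' - k) z" by (simp add: int_dot_diff)
  with assms show ?thesis by (simp add: alias_set_def)
qed

text \<open>A dual lattice vector inside a box of the cross is the difference of its positive and its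
  negative part, and both parts lie in the cross.\<close>

lemma separated_alias_set:
  fixes z :: "int ^ 'n::finite"
  assumes "R \<ge> 1" "reconstructing_lattice (hyperbolic_cross R) z M"
  shows "separated (cross_radius R CARD('n)) (alias_set z M k)"
  unfolding separated_def
proof (intro allI impI ballI)
  fix i :: "'n \<Rightarrow> nat" and l l'
  assume i: "sum i UNIV = cross_radius R CARD('n)"
    and l: "l \<in> alias_set z M k" "l' \<in> alias_set z M k" and close: "\<forall>s. \<bar>l $ s - l' $ s\<bar> < 2 ^ i s"
  define p q where "p = (\<chi> s. max 0 (l $ s - l' $ s))" and "q = (\<chi> s. max 0 (l' $ s - l $ s))"
  have in_cross: "h \<in> hyperbolic_cross R" if h: "\<And>s. \<bar>h $ s\<bar> \<le> 2 ^ i s" for h :: "int ^ 'n"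
  proof -
    have "total_lev h \<le> sum i UNIV"
      unfolding total_lev_def by (intro sum_mono lev_le h)
    then show ?thesis using i hyperbolic_cross_iff[OF assms(1)] by metis
  qed
  have "\<bar>p $ s\<bar> \<le> 2 ^ i s" "\<bar>q $ s\<bar> \<le> 2 ^ i s" for s
    using spec[OF close, of s] by (auto simp: p_def q_def)
  then have "p \<in> hyperbolic_cross R" "q \<in> hyperbolic_cross R" by (auto intro: in_cross)
  moreover have pq: "p - q = l - l'"
    by (auto simp: p_def q_def vec_eq_iff max_def)
  then have "int M dvd int_dot (p - q) z" using alias_set_dvd[OF l] by simp
  ultimately have "p = q"
    using reconstructing_lattice_distinct[OF assms(2) finite_hyperbolic_cross[OF assms(1)]] by blast
  with pq show "l = l'" by simp
qed

lemma alias_set_outside_cross: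
  assumes "R \<ge> 1" "reconstructing_lattice (hyperbolic_cross R) z M" "k \<in> hyperbolic_cross R" "l \<in> alias_set z M k"
  shows "l \<notin> hyperbolic_cross R"
  using reconstructing_lattice_distinct[OF assms(2) finite_hyperbolic_cross[OF assms(1)] _ assms(3), of l] assms(4)
  by (auto simp: alias_set_def)

lemma alias_set_disjoint:
  assumes "R \<ge> 1" "reconstructing_lattice (hyperbolic_cross R) z M" "k \<in> hyperbolic_cross R" "k' \<in> hyperbolic_cross R"
    and "l \<in> alias_set z M k" "l \<in> alias_set z M k'"
  shows "k = k'"
proof (rule reconstructing_lattice_distinct[OF assms(2) finite_hyperbolic_cross[OF assms(1)] assms(3,4)])
  have "int_dot (k - k') z = int_dot (l - k') z - int_dot (l - k) z" by (simp add: int_dot_diff)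
  with assms(5,6) show "int M dvd int_dot (k - k') z" by (simp add: alias_set_def)
qed

text \<open>The finite inequality bounds all partial sums of the moduli uniformly, which yields
  summability and the estimate together. On all frequencies it gives absolute convergence of the
  Fourier series, on a punctured coset the size of the aliasing term.\<close>

lemma weighted_sum_Cauchy_Schwarz:
  fixes c :: "'a \<Rightarrow> complex" and w :: "'a \<Rightarrow> real"
  assumes w: "\<And>l. w l > 0"
    and T: "\<And>F. finite F \<Longrightarrow> F \<subseteq> X \<Longrightarrow> (\<Sum>l\<in>F. 1 / w l) \<le> T"
    and c: "(\<lambda>l. (cmod (c l))\<^sup>2 * w l) summable_on X"
  shows "(\<lambda>l. cmod (c l)) summable_on X"
    and "(cmod (infsum c X))\<^sup>2 \<le> T * (\<Sum>\<^sub>\<infinity>l\<in>X. (cmod (c l))\<^sup>2 * w l)"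
proof -
  let ?A = "\<Sum>\<^sub>\<infinity>l\<in>X. (cmod (c l))\<^sup>2 * w l"
  have T0: "T \<ge> 0" using T[of "{}"] by simp
  have A0: "?A \<ge> 0" by (intro infsum_nonneg mult_nonneg_nonneg less_imp_le[OF w]) simp
  have fin: "(\<Sum>l\<in>F. cmod (c l)) \<le> sqrt (T * ?A)" if F: "finite F" "F \<subseteq> X" for F
  proof (rule real_le_rsqrt)
    have "(\<Sum>l\<in>F. cmod (c l))\<^sup>2 = (\<Sum>l\<in>F. (1 / sqrt (w l)) * (cmod (c l) * sqrt (w l)))\<^sup>2"
      using w by (intro arg_cong[of _ _ "\<lambda>x. x\<^sup>2"] sum.cong) (auto simp: less_imp_neq[OF w, symmetric])
    also have "\<dots> \<le> (\<Sum>l\<in>F. (1 / sqrt (w l))\<^sup>2) * (\<Sum>l\<in>F. (cmod (c l) * sqrt (w l))\<^sup>2)"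
      by (rule Cauchy_Schwarz_ineq_sum)
    also have "\<dots> = (\<Sum>l\<in>F. 1 / w l) * (\<Sum>l\<in>F. (cmod (c l))\<^sup>2 * w l)"
      using less_imp_le[OF w] by (simp add: power_divide power_mult_distrib)
    also have "\<dots> \<le> T * ?A"
      using F c w
      by (intro mult_mono T finite_sum_le_infsum sum_nonneg T0) (auto simp: less_imp_le)
    finally show "(\<Sum>l\<in>F. cmod (c l))\<^sup>2 \<le> T * ?A" .
  qed
  show sm: "(\<lambda>l. cmod (c l)) summable_on X"
    by (rule nonneg_bdd_above_summable_on) (auto intro!: bdd_aboveI2 fin)
  have "cmod (infsum c X) \<le> (\<Sum>\<^sub>\<infinity>l\<in>X. cmod (c l))"
    by (rule norm_infsum_bound[OF sm])
  also have "\<dots> \<le> sqrt (T * ?A)"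
    by (rule infsum_le_finite_sums[OF sm fin])
  finally have "(cmod (infsum c X))\<^sup>2 \<le> (sqrt (T * ?A))\<^sup>2" by (intro power_mono) auto
  then show "(cmod (infsum c X))\<^sup>2 \<le> T * ?A" using T0 A0 by simp
qed

section \<open>Error bounds\<close>

lemma disjoint_infsum_le:
  fixes u :: "'a \<Rightarrow> real"
  assumes "u summable_on UNIV" "\<And>l. u l \<ge> 0" "finite G"
    and "\<And>k k' l. k \<in> G \<Longrightarrow> k' \<in> G \<Longrightarrow> l \<in> X k \<Longrightarrow> l \<in> X k' \<Longrightarrow> k = k'"
  shows "(\<Sum>k\<in>G. infsum u (X k)) \<le> infsum u UNIV"
proof -
  have sm: "u summable_on A" for A
    using summable_on_subset_banach[OF assms(1)] by blast
  have "(\<Sum>k\<in>G. infsum u (X k)) = infsum u (\<Union>k\<in>G. X k)"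
    using assms(3,4)
  proof (induction G rule: finite_induct)
    case (insert k G)
    have "X k \<inter> (\<Union>k\<in>G. X k) = {}" using insert.prems insert.hyps by blast
    then have "infsum u (X k \<union> (\<Union>k\<in>G. X k)) = infsum u (X k) + infsum u (\<Union>k\<in>G. X k)"
      by (rule infsum_Un_disjoint[OF sm sm])
    moreover have "(\<Sum>k\<in>G. infsum u (X k)) = infsum u (\<Union>k\<in>G. X k)"
      by (rule insert.IH) (use insert.prems in blast)
    ultimately show ?case using insert.hyps by simp
  qed simp
  also have "\<dots> \<le> infsum u UNIV"
    by (rule infsum_mono_neutral[OF sm sm]) (use assms(2) in auto)
  finally show ?thesis .
qed

text \<open>Membership is needed along with the estimate, because the norm is infinite outside the
  space.\<close>

lemma hybrid_spaceI:
  assumes "periodic g" "continuous_on UNIV g"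
    and bound: "\<And>F. finite F \<Longrightarrow> (\<Sum>k\<in>F. (cmod (fourier_coeff g k))\<^sup>2 * hybrid_weight \<alpha> \<beta> k) \<le> B"
  shows "g \<in> hybrid_space \<alpha> \<beta>" "hybrid_norm \<alpha> \<beta> g \<le> ennreal (sqrt B)"
proof -
  have "(\<lambda>k. (cmod (fourier_coeff g k))\<^sup>2 * hybrid_weight \<alpha> \<beta> k) summable_on UNIV"
    by (rule nonneg_bdd_above_summable_on)
       (auto intro!: bdd_aboveI2 bound mult_nonneg_nonneg less_imp_le[OF hybrid_weight_pos])
  then show "g \<in> hybrid_space \<alpha> \<beta>" "hybrid_norm \<alpha> \<beta> g \<le> ennreal (sqrt B)"
    using L2_torus_continuous[OF assms(1,2)] bound
    by (auto simp: hybrid_space_def hybrid_norm_def intro!: ennreal_leI infsum_le_finite_sums)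
qed

text \<open>\<open>D\<close> bounds the projection error and \<open>V * T\<close> the aliasing
  error, both squared. \<open>T0\<close> only secures the absolute convergence of the Fourier series
  and does not enter the bound.\<close>

lemma sampling_error_norm_le:
  fixes f :: "real ^ 'n::finite \<Rightarrow> complex" and \<alpha> \<beta> \<gamma> :: real
  assumes R: "R \<ge> 1" and rec: "reconstructing_lattice (hyperbolic_cross R) z M"
    and f: "f \<in> cont_hybrid_space \<alpha> \<beta>" "hybrid_norm \<alpha> \<beta> f \<le> 1"
    and T0: "\<And>F. finite F \<Longrightarrow> (\<Sum>l\<in>F. 1 / hybrid_weight \<alpha> \<beta> (l :: int ^ 'n)) \<le> T0"
    and T: "\<And>k F. k \<in> hyperbolic_cross R \<Longrightarrow> finite F \<Longrightarrow> F \<subseteq> alias_set z M k \<Longrightarrow> (\<Sum>l\<in>F. 1 / hybrid_weight \<alpha> \<beta> l) \<le> T"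
    and V: "\<And>k :: int ^ 'n. k \<in> hyperbolic_cross R \<Longrightarrow> hybrid_weight 0 \<gamma> k \<le> V"
    and D: "\<And>k :: int ^ 'n. k \<notin> hyperbolic_cross R \<Longrightarrow> hybrid_weight 0 \<gamma> k \<le> D * hybrid_weight \<alpha> \<beta> k"
    and nonneg: "V \<ge> 0" "D \<ge> 0" "T \<ge> 0"
  shows "sobolev_norm \<gamma> (\<lambda>x. f x - sampling_op (hyperbolic_cross R) z M f x) \<le> ennreal (sqrt (D + V * T))"
proof -
  let ?H = "hyperbolic_cross R :: (int ^ 'n) set" and ?w = "hybrid_weight \<alpha> \<beta> :: int ^ 'n \<Rightarrow> real"
  define c where "c = fourier_coeff f"
  define u where "u l = (cmod (c l))\<^sup>2 * ?w l" for l
  define g where "g x = f x - sampling_op ?H z M f x" for x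
  have fs: "f \<in> hybrid_space \<alpha> \<beta>" and fc: "continuous_on UNIV f" and fp: "periodic f"
    using f(1) by (auto simp: cont_hybrid_space_def hybrid_space_def L2_torus_def)
  have M: "M \<ge> 1" using rec by (simp add: reconstructing_lattice_def)
  have finH: "finite ?H" by (rule finite_hyperbolic_cross[OF R])
  have u_sm: "u summable_on UNIV" using fs by (simp add: hybrid_space_def u_def[abs_def] c_def)
  have u_sm': "u summable_on A" for A
    using summable_on_subset_banach[OF u_sm] by blast
  have u_nonneg: "u l \<ge> 0" for l
    unfolding u_def by (intro mult_nonneg_nonneg less_imp_le[OF hybrid_weight_pos]) simp
  have "ennreal (sqrt (infsum u UNIV)) \<le> 1"
    using f(2) fs by (simp add: hybrid_norm_def u_def[abs_def] c_def)
  then have u_le: "infsum u UNIV \<le> 1" by simp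
  have c_sm: "(\<lambda>l. cmod (c l)) summable_on UNIV"
    by (rule weighted_sum_Cauchy_Schwarz(1)[of ?w UNIV T0 c])
       (auto intro: hybrid_weight_pos T0 u_sm[unfolded u_def[abs_def]])
  have c_sm': "c summable_on A" for A
    using summable_on_subset_banach[OF abs_summable_summable[OF c_sm]] by blast
  have series: "((\<lambda>l. c l * fourier_exp l x) has_sum f x) UNIV" for x
    using fourier_series_pointwise[OF fp fc] c_sm by (simp add: c_def)
  have gp: "periodic g" and gc: "continuous_on UNIV g"
    unfolding g_def[abs_def] sampling_op_def
    by (intro periodic_diff fp periodic_trig_sum continuous_on_diff fc continuous_trig_sum)+
  have g_coeff: "fourier_coeff g k = c k - (if k \<in> ?H then lattice_coeff z M f k else 0)" for k
    unfolding g_def[abs_def] sampling_op_def c_def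
    by (subst fourier_coeff_diff[OF fc continuous_trig_sum]) (simp add: fourier_coeff_trig_sum[OF finH])
  have in_cross: "(cmod (fourier_coeff g k))\<^sup>2 * hybrid_weight 0 \<gamma> k \<le> V * T * infsum u (alias_set z M k)" if k: "k \<in> ?H" for k
  proof -
    \<comment> \<open>The term \<open>k\<close> of the coset is the true coefficient, so up to sign
      the error coefficient is the sum over the punctured coset.\<close>
    have "{l. int M dvd int_dot (l - k) z} = insert k (alias_set z M k)"
      by (auto simp: alias_set_def int_dot_def)
    then have "lattice_coeff z M f k = infsum c (insert k (alias_set z M k))"
      using infsumI[OF lattice_coeff_aliasing[OF M series]] by metis
    also have "\<dots> = c k + infsum c (alias_set z M k)"
      by (rule infsum_insert[OF c_sm']) (simp add: alias_set_def)
    finally have "cmod (fourier_coeff g k) = cmod (infsum c (alias_set z M k))"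
      using k by (simp add: g_coeff)
    moreover have "(cmod (infsum c (alias_set z M k)))\<^sup>2 \<le> T * infsum u (alias_set z M k)"
      unfolding u_def[abs_def]
      by (rule weighted_sum_Cauchy_Schwarz(2)) (auto intro: hybrid_weight_pos T[OF k] u_sm'[unfolded u_def[abs_def]])
    ultimately have "(cmod (fourier_coeff g k))\<^sup>2 * hybrid_weight 0 \<gamma> k \<le> (T * infsum u (alias_set z M k)) * V"
      using nonneg by (intro mult_mono V k less_imp_le[OF hybrid_weight_pos] mult_nonneg_nonneg infsum_nonneg u_nonneg) auto
    then show ?thesis by (simp add: mult_ac)
  qed
  have "(\<Sum>k\<in>F. (cmod (fourier_coeff g k))\<^sup>2 * hybrid_weight 0 \<gamma> k) \<le> D + V * T" if F: "finite F" for F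
  proof -
    have "(\<Sum>k\<in>F - ?H. (cmod (fourier_coeff g k))\<^sup>2 * hybrid_weight 0 \<gamma> k) \<le> (\<Sum>k\<in>F - ?H. D * u k)"
    proof (rule sum_mono)
      fix k assume k: "k \<in> F - ?H"
      then have "(cmod (c k))\<^sup>2 * hybrid_weight 0 \<gamma> k \<le> (cmod (c k))\<^sup>2 * (D * ?w k)"
        by (intro mult_left_mono D) auto
      with k show "(cmod (fourier_coeff g k))\<^sup>2 * hybrid_weight 0 \<gamma> k \<le> D * u k"
        by (simp add: g_coeff u_def mult_ac)
    qed
    also have "\<dots> = D * (\<Sum>k\<in>F - ?H. u k)" by (rule sum_distrib_left[symmetric])
    also have "\<dots> \<le> D * 1"
      using finite_sum_le_infsum[OF u_sm, of "F - ?H"] F u_le u_nonneg nonneg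
      by (intro mult_left_mono) (auto intro: order_trans)
    finally have 1: "(\<Sum>k\<in>F - ?H. (cmod (fourier_coeff g k))\<^sup>2 * hybrid_weight 0 \<gamma> k) \<le> D" by simp
    have "(\<Sum>k\<in>F \<inter> ?H. (cmod (fourier_coeff g k))\<^sup>2 * hybrid_weight 0 \<gamma> k) \<le> (\<Sum>k\<in>F \<inter> ?H. V * T * infsum u (alias_set z M k))"
      by (intro sum_mono in_cross) auto
    also have "\<dots> = V * T * (\<Sum>k\<in>F \<inter> ?H. infsum u (alias_set z M k))"
      by (rule sum_distrib_left[symmetric])
    \<comment> \<open>The cosets of distinct cross elements are disjoint, so the norm of
      \<open>f\<close> is spent only once and the size of the cross does not enter.\<close>
    also have "(\<Sum>k\<in>F \<inter> ?H. infsum u (alias_set z M k)) \<le> infsum u UNIV"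
      using F by (intro disjoint_infsum_le u_sm u_nonneg) (auto intro: alias_set_disjoint[OF R rec])
    then have "V * T * (\<Sum>k\<in>F \<inter> ?H. infsum u (alias_set z M k)) \<le> V * T * 1"
      using u_le nonneg by (intro mult_left_mono) auto
    finally have 2: "(\<Sum>k\<in>F \<inter> ?H. (cmod (fourier_coeff g k))\<^sup>2 * hybrid_weight 0 \<gamma> k) \<le> V * T" by simp
    show ?thesis
      using 1 2 sum.Int_Diff[OF F, of "\<lambda>k. (cmod (fourier_coeff g k))\<^sup>2 * hybrid_weight 0 \<gamma> k" ?H] by simp
  qed
  from hybrid_spaceI(2)[OF gp gc this] show ?thesis
    by (simp add: sobolev_norm_def g_def[abs_def])
qed

section \<open>Weights inside and outside the cross\<close>

lemma hybrid_weight_zero: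
  "hybrid_weight 0 \<gamma> k = (1 + (\<Sum>s\<in>UNIV. (real_of_int (k $ s))\<^sup>2)) powr \<gamma>"
  by (simp add: hybrid_weight_def less_imp_neq[OF one_plus_sq_pos, symmetric])

lemma one_plus_sum_le_prod:
  fixes f :: "'a \<Rightarrow> real"
  assumes "finite A" "\<And>a. a \<in> A \<Longrightarrow> f a \<ge> 0"
  shows "1 + sum f A \<le> (\<Prod>a\<in>A. 1 + f a)"
  using assms
proof (induction A rule: finite_induct)
  case (insert a A)
  then have IH: "1 + sum f A \<le> (\<Prod>a\<in>A. 1 + f a)" and nonneg: "f a \<ge> 0" "sum f A \<ge> 0"
    by (auto intro: sum_nonneg)
  have "1 + sum f (insert a A) \<le> (1 + f a) * (1 + sum f A)"
    using insert.hyps nonneg by (simp add: ring_distribs)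
  also have "\<dots> \<le> (1 + f a) * (\<Prod>a\<in>A. 1 + f a)"
    using IH nonneg by (intro mult_left_mono) auto
  finally show ?case using insert.hyps by simp
qed simp

text \<open>The isotropic factor \<open>?S\<close> is at most the product \<open>?P\<close>, so its
  excess power \<open>\<gamma> - \<beta> \<ge> 0\<close> can be moved to \<open>?P\<close>.
  Splitting off \<open>?P powr \<alpha>\<close> leaves a negative power of \<open>?P\<close>, and
  \<open>?P\<close> is large outside the cross.\<close>

lemma outside_cross_weight_le:
  fixes k :: "int ^ 'n::finite"
  assumes "\<beta> \<le> 0" "\<gamma> \<ge> 0" "\<alpha> + \<beta> > \<gamma>" "R \<ge> 1" "k \<notin> hyperbolic_cross R"
  shows "hybrid_weight 0 \<gamma> k \<le> (4 powr (\<alpha> + \<beta> - \<gamma>) * 4 powr (- (\<alpha> + \<beta> - \<gamma>) * R)) * hybrid_weight \<alpha> \<beta> k"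
proof -
  let ?S = "1 + (\<Sum>s\<in>UNIV. (real_of_int (k $ s))\<^sup>2)" and ?P = "\<Prod>s\<in>UNIV. 1 + (real_of_int (k $ s))\<^sup>2"
  define \<sigma> where "\<sigma> = \<alpha> + \<beta> - \<gamma>"
  have S: "?S \<ge> 1" and P: "?P \<ge> 1"
    by (rule one_plus_norm_sq_ge_1, rule prod_one_plus_sq_ge_1)
  have SP: "?S \<le> ?P" by (rule one_plus_sum_le_prod) auto
  have d: "CARD('n) \<ge> 1" by (simp add: Suc_leI)
  have "total_lev k > cross_radius R CARD('n)"
    using assms hyperbolic_cross_iff[of R k] by simp
  \<comment> \<open>Outside the cross the total level is at least floor R + d; the summand d cancels
    the factor 4^d lost in \<open>prod_weight_ge_total_lev\<close>. Bounding floor R below by R - 1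
    leaves the constant \<open>4 powr (\<alpha> + \<beta> - \<gamma>)\<close>.\<close>
  then have "nat \<lfloor>R\<rfloor> + CARD('n) \<le> total_lev k" using d by (simp add: cross_radius_def)
  then have "(4::real) ^ (nat \<lfloor>R\<rfloor> + CARD('n)) \<le> 4 ^ total_lev k" by (intro power_increasing) auto
  also note prod_weight_ge_total_lev[of k]
  finally have "4 ^ nat \<lfloor>R\<rfloor> \<le> ?P" by (simp add: power_add)
  moreover have "R - 1 \<le> real (nat \<lfloor>R\<rfloor>)" using assms(4) by linarith
  then have "4 powr (R - 1) \<le> 4 powr (real (nat \<lfloor>R\<rfloor>))" by (rule powr_mono) simp
  ultimately have P': "4 powr (R - 1) \<le> ?P" by (simp add: powr_realpow)
  have "?S powr \<gamma> = ?S powr \<beta> * ?S powr (\<gamma> - \<beta>)"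
    by (simp flip: powr_add)
  also have "\<dots> \<le> ?S powr \<beta> * ?P powr (\<gamma> - \<beta>)"
    using S SP assms by (intro mult_left_mono powr_mono2) auto
  also have "?P powr (\<gamma> - \<beta>) = ?P powr \<alpha> * ?P powr (- \<sigma>)"
    by (simp add: \<sigma>_def flip: powr_add)
  also have "\<dots> \<le> ?P powr \<alpha> * (4 powr (R - 1)) powr (- \<sigma>)"
    using P' assms by (intro mult_left_mono powr_mono2') (auto simp: \<sigma>_def)
  also have "(4 powr (R - 1)) powr (- \<sigma>) = 4 powr \<sigma> * 4 powr (- \<sigma> * R)"
    by (simp add: powr_powr algebra_simps flip: powr_add)
  finally have "?S powr \<gamma> \<le> ?S powr \<beta> * (?P powr \<alpha> * (4 powr \<sigma> * 4 powr (- \<sigma> * R)))"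
    by (simp add: mult_left_mono)
  then show ?thesis
    unfolding hybrid_weight_zero hybrid_weight_alt[of \<alpha>] \<sigma>_def by (simp only: mult_ac)
qed

text \<open>A single coordinate may use up the whole level budget, so on the axes the weight does
  reach the order \<open>4 powr (\<gamma> * R)\<close>.\<close>

lemma inside_cross_weight_le:
  fixes k :: "int ^ 'n::finite"
  assumes "\<gamma> \<ge> 0" "R \<ge> 1" "k \<in> hyperbolic_cross R"
  shows "hybrid_weight 0 \<gamma> k \<le> (1 + real CARD('n)) powr \<gamma> * 4 powr (\<gamma> * real CARD('n)) * 4 powr (\<gamma> * R)"
proof -
  let ?n = "cross_radius R CARD('n)"
  have "lev (k $ s) \<le> ?n" for s
  proof -
    have "lev (k $ s) \<le> total_lev k" unfolding total_lev_def by (rule member_le_sum) auto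
    then show ?thesis using assms(3) hyperbolic_cross_iff[OF assms(2), of k] by simp
  qed
  then have "1 + (\<Sum>s\<in>UNIV. (real_of_int (k $ s))\<^sup>2) \<le> (1 + real CARD('n)) * 4 ^ ?n"
    by (rule one_plus_norm_sq_le_lev)
  also have "\<dots> \<le> (1 + real CARD('n)) * 4 powr (real CARD('n) + R)"
  proof -
    have "real ?n \<le> real CARD('n) + R" using assms(2) by (simp add: cross_radius_def) linarith
    then have "4 powr real ?n \<le> 4 powr (real CARD('n) + R)" by (intro powr_mono) auto
    then show ?thesis by (intro mult_left_mono) (simp_all add: powr_realpow)
  qed
  finally have "hybrid_weight 0 \<gamma> k \<le> ((1 + real CARD('n)) * 4 powr (real CARD('n) + R)) powr \<gamma>"
    unfolding hybrid_weight_zero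
    using assms(1) one_plus_norm_sq_ge_1[of k] by (intro powr_mono2) auto
  also have "\<dots> = (1 + real CARD('n)) powr \<gamma> * 4 powr (\<gamma> * real CARD('n)) * 4 powr (\<gamma> * R)"
  proof -
    have "4 powr ((real CARD('n) + R) * \<gamma>) = 4 powr (\<gamma> * real CARD('n)) * 4 powr (\<gamma> * R)"
      by (simp add: algebra_simps flip: powr_add)
    then show ?thesis by (simp add: powr_mult powr_powr)
  qed
  finally show ?thesis .
qed

text \<open>The floor loses less than 1, which the summand d - 1 \<ge> 1 restores.\<close>

lemma cross_radius_ge:
  assumes "R \<ge> 1" "d \<ge> 2"
  shows "R \<le> real (cross_radius R d)" "real (cross_radius R d) \<le> R + real d - 1"
  using assms by (auto simp: cross_radius_def of_nat_diff; linarith)+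

text \<open>The squared aliasing error is the largest weight on the cross, of order
  \<open>4 powr (\<gamma> * R)\<close>, times a coset sum of order
  \<open>4 powr (- (\<alpha> + \<beta>) * R) * R ^ q\<close>. Its exponential rate is that of the
  squared projection error, and the square root halves the exponent of \<open>R\<close>.\<close>

lemma sampling_error_upper_bound:
  fixes \<alpha> \<beta> \<gamma> :: real
  assumes "\<beta> \<le> 0" "\<gamma> \<ge> 0" "\<alpha> + \<beta> > \<gamma>" "\<alpha> + \<beta> > 1/2" "CARD('n::finite) \<ge> 2"
  shows "\<exists>c>0. \<forall>R\<ge>1. \<forall>(z :: int ^ 'n) M f. reconstructing_lattice (hyperbolic_cross R) z M \<longrightarrow>
    f \<in> cont_hybrid_space \<alpha> \<beta> \<longrightarrow> hybrid_norm \<alpha> \<beta> f \<le> 1 \<longrightarrow>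
    sobolev_norm \<gamma> (\<lambda>x. f x - sampling_op (hyperbolic_cross R) z M f x)
      \<le> ennreal (c * (2 powr (- (\<alpha> + \<beta> - \<gamma>) * R) * (if \<beta> = 0 then R powr ((real CARD('n) - 1) / 2) else 1)))"
proof -
  define d where "d = CARD('n)"
  have d: "d \<ge> 2" using assms(5) by (simp add: d_def)
  define q where "q = (if \<beta> = 0 then d - 1 else 0)"
  define \<sigma> where "\<sigma> = \<alpha> + \<beta> - \<gamma>"
  obtain C where C: "C > 0" and C': "\<And>m (X :: (int ^ 'n) set) F. separated m X \<Longrightarrow> (\<And>k. k \<in> X \<Longrightarrow> m \<le> total_lev k) \<Longrightarrow>
     finite F \<Longrightarrow> F \<subseteq> X \<Longrightarrow>
     (\<Sum>k\<in>F. 1 / hybrid_weight \<alpha> \<beta> k) \<le> C * (real (m + 1) ^ q * 4 powr (- (\<alpha> + \<beta>) * real m))"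
    using inverse_weight_sum_le[OF assms(1,4), where 'n = 'n] unfolding q_def d_def by blast
  define V0 where "V0 = (1 + real d) powr \<gamma> * 4 powr (\<gamma> * real d)"
  define c where "c = sqrt (4 powr \<sigma> + V0 * (C * (1 + real d) ^ q))"
  have V0: "V0 > 0" by (simp add: V0_def)
  have c: "c > 0" using V0 C by (auto simp: c_def intro!: add_pos_nonneg)
  have "sobolev_norm \<gamma> (\<lambda>x. f x - sampling_op (hyperbolic_cross R) z M f x)
      \<le> ennreal (c * (2 powr (- \<sigma> * R) * (if \<beta> = 0 then R powr ((real d - 1) / 2) else 1)))"
    if R: "R \<ge> 1" and rec: "reconstructing_lattice (hyperbolic_cross R) z M"
      and f: "f \<in> cont_hybrid_space \<alpha> \<beta>" "hybrid_norm \<alpha> \<beta> f \<le> 1" for R and z :: "int ^ 'n" and M f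
  proof -
    define n where "n = cross_radius R d"
    have n: "R \<le> real n" "real n \<le> R + real d - 1"
      using cross_radius_ge[OF R d] by (auto simp: n_def)
    define T where "T = C * (1 + real d) ^ q * R ^ q * 4 powr (- (\<alpha> + \<beta>) * R)"
    have T0: "(\<Sum>l\<in>F. 1 / hybrid_weight \<alpha> \<beta> (l :: int ^ 'n)) \<le> C" if "finite F" for F
    proof -
      \<comment> \<open>Distinct integer points differ by at least 1 in some coordinate, so the set
        of all frequencies is separated for \<open>m = 0\<close>, and the coset estimate yields
        summability of all reciprocal weights.\<close>
      have "separated 0 (UNIV :: (int ^ 'n) set)" by (auto simp: separated_def vec_eq_iff)
      from C'[OF this _ that] show ?thesis by simp
    qed
    have T: "(\<Sum>l\<in>F. 1 / hybrid_weight \<alpha> \<beta> l) \<le> T"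
      if k: "k \<in> hyperbolic_cross R" and F: "finite F" "F \<subseteq> alias_set z M k" for k F
    proof -
      have lev: "n \<le> total_lev l" if "l \<in> alias_set z M k" for l
        using alias_set_outside_cross[OF R rec k that] hyperbolic_cross_iff[OF R, of l] by (simp add: n_def d_def)
      have "separated n (alias_set z M k)"
        unfolding n_def d_def by (rule separated_alias_set[OF R rec])
      from C'[OF this lev F]
      have "(\<Sum>l\<in>F. 1 / hybrid_weight \<alpha> \<beta> l) \<le> C * (real (n + 1) ^ q * 4 powr (- (\<alpha> + \<beta>) * real n))" .
      also have "\<dots> \<le> C * (((1 + real d) * R) ^ q * 4 powr (- (\<alpha> + \<beta>) * R))"
      proof (intro mult_left_mono[OF mult_mono])
        \<comment> \<open>As \<open>R \<ge> 1\<close>, the bound R + d for n + 1 becomes a multiple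
          of \<open>R\<close>.\<close>
        have "real d * 1 \<le> real d * R" using R by (intro mult_left_mono) auto
        then have "real (n + 1) \<le> (1 + real d) * R" using n(2) by (simp add: ring_distribs)
        then show "real (n + 1) ^ q \<le> ((1 + real d) * R) ^ q" by (rule power_mono) simp
        have "- (\<alpha> + \<beta>) * real n \<le> - (\<alpha> + \<beta>) * R"
          using n(1) assms(4) by (intro mult_left_mono_neg) auto
        then show "4 powr (- (\<alpha> + \<beta>) * real n) \<le> 4 powr (- (\<alpha> + \<beta>) * R)" by (rule powr_mono) simp
      qed (use C R in auto)
      also have "\<dots> = T" by (simp add: T_def power_mult_distrib mult_ac)
      finally show ?thesis .
    qed
    have T_nonneg: "T \<ge> 0" using C R by (simp add: T_def)
    have "sobolev_norm \<gamma> (\<lambda>x. f x - sampling_op (hyperbolic_cross R) z M f x)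
      \<le> ennreal (sqrt (4 powr \<sigma> * 4 powr (- \<sigma> * R) + V0 * 4 powr (\<gamma> * R) * T))"
    proof (rule sampling_error_norm_le[OF R rec f, of C])
      show "hybrid_weight 0 \<gamma> k \<le> V0 * 4 powr (\<gamma> * R)" if "k \<in> hyperbolic_cross R" for k :: "int ^ 'n"
        using inside_cross_weight_le[OF assms(2) R that] by (simp add: V0_def d_def)
      show "hybrid_weight 0 \<gamma> k \<le> 4 powr \<sigma> * 4 powr (- \<sigma> * R) * hybrid_weight \<alpha> \<beta> k" if "k \<notin> hyperbolic_cross R" for k :: "int ^ 'n"
        using outside_cross_weight_le[OF assms(1-3) R that] by (simp add: \<sigma>_def)
    qed (use V0 T_nonneg T0 T in auto)
    also have "\<dots> \<le> ennreal (sqrt (c\<^sup>2 * (4 powr (- \<sigma> * R) * R ^ q)))"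
    proof (intro ennreal_leI real_sqrt_le_mono)
      have "1 \<le> R ^ q" using R by (rule one_le_power)
      then have le: "4 powr \<sigma> * 4 powr (- \<sigma> * R) * 1 \<le> 4 powr \<sigma> * 4 powr (- \<sigma> * R) * R ^ q"
        by (intro mult_left_mono) auto
      have VT: "V0 * 4 powr (\<gamma> * R) * T = V0 * (C * (1 + real d) ^ q) * (4 powr (- \<sigma> * R) * R ^ q)"
      proof -
        have "4 powr (- \<sigma> * R) = 4 powr (\<gamma> * R) * 4 powr (- (\<alpha> + \<beta>) * R)"
          by (simp add: \<sigma>_def algebra_simps flip: powr_add)
        then show ?thesis by (simp only: T_def mult_ac)
      qed
      have c2: "c\<^sup>2 = 4 powr \<sigma> + V0 * (C * (1 + real d) ^ q)"
        using V0 C by (simp add: c_def)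
      show "4 powr \<sigma> * 4 powr (- \<sigma> * R) + V0 * 4 powr (\<gamma> * R) * T \<le> c\<^sup>2 * (4 powr (- \<sigma> * R) * R ^ q)"
        using le unfolding VT c2 distrib_right by (simp only: mult.assoc mult_1_right add_right_mono)
    qed
    also have "sqrt (c\<^sup>2 * (4 powr (- \<sigma> * R) * R ^ q)) = c * (2 powr (- \<sigma> * R) * (if \<beta> = 0 then R powr ((real d - 1) / 2) else 1))"
    proof (rule real_sqrt_unique)
      have "(2 powr (- \<sigma> * R))\<^sup>2 = 4 powr (- \<sigma> * R)"
        by (simp add: power2_eq_square flip: powr_mult)
      moreover have "(if \<beta> = 0 then R powr ((real d - 1) / 2) else 1)\<^sup>2 = R ^ q"
      proof (cases "\<beta> = 0")
        case True
        have "(R powr ((real d - 1) / 2))\<^sup>2 = R powr real (d - 1)"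
          using d by (simp add: power2_eq_square of_nat_diff flip: powr_add)
        then show ?thesis using R True by (simp add: q_def powr_realpow)
      qed (simp add: q_def)
      ultimately show "(c * (2 powr (- \<sigma> * R) * (if \<beta> = 0 then R powr ((real d - 1) / 2) else 1)))\<^sup>2 = c\<^sup>2 * (4 powr (- \<sigma> * R) * R ^ q)"
        by (simp only: power_mult_distrib)
    qed (use c in auto)
    finally show ?thesis .
  qed
  then show ?thesis using c unfolding d_def \<sigma>_def by blast
qed

section \<open>Lower bound from aliasing frequencies on the axes\<close>

lemma axis_alias_pair:
  fixes z :: "int ^ 'n::finite"
  assumes "M \<ge> 1" "s \<noteq> t"
  obtains a b :: int where "(axis s a :: int ^ 'n) \<noteq> axis t b" "int M dvd int_dot (axis s a - axis t b) z"
    "a\<^sup>2 \<le> int M" "b\<^sup>2 \<le> int M"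
proof -
  define m where "m = nat \<lfloor>sqrt (real M)\<rfloor>"
  have m: "real m \<le> sqrt (real M)" "sqrt (real M) < real m + 1"
    unfolding m_def by (auto simp: of_nat_nat)
  have "(real m)\<^sup>2 \<le> (sqrt (real M))\<^sup>2" by (rule power_mono[OF m(1)]) simp
  then have m2: "m\<^sup>2 \<le> M" by (simp flip: of_nat_power)
  have "(sqrt (real M))\<^sup>2 < (real (m + 1))\<^sup>2" by (rule power_strict_mono) (use m in auto)
  then have "real M < real ((m + 1)\<^sup>2)" by (simp only: of_nat_power real_sqrt_pow2 of_nat_0_le_iff)
  then have m3: "M < (m + 1)\<^sup>2" by (simp only: of_nat_less_iff)
  define S where "S = {0..int m} \<times> {0..int m}"
  define \<phi> where "\<phi> = (\<lambda>(a, b). (a * z $ s + b * z $ t) mod int M)"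
  have "card (\<phi> ` S) \<le> card {0..<int M}"
    by (rule card_mono) (use assms(1) in \<open>auto simp: \<phi>_def\<close>)
  also have "\<dots> < card S" using m3 by (simp add: S_def power2_eq_square nat_add_distrib)
  finally have "\<not> inj_on \<phi> S" by (rule pigeonhole)
  then obtain a b a' b' where ab: "(a, b) \<in> S" "(a', b') \<in> S" "(a, b) \<noteq> (a', b')"
    "(a * z $ s + b * z $ t) mod int M = (a' * z $ s + b' * z $ t) mod int M"
    unfolding inj_on_def \<phi>_def by auto
  have dot: "int_dot (axis r x) z = x * z $ r" for r x
    by (simp add: int_dot_def axis_def if_distrib[of "\<lambda>u. u * _"] cong: if_cong)
  have bnd: "(x - y)\<^sup>2 \<le> int M" if "0 \<le> x" "x \<le> int m" "0 \<le> y" "y \<le> int m" for x y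
  proof -
    have "\<bar>x - y\<bar>\<^sup>2 \<le> (int m)\<^sup>2" using that by (intro power_mono) auto
    also have "\<dots> \<le> int M" using m2 by (simp flip: of_nat_power)
    finally show ?thesis by simp
  qed
  show thesis
  proof (rule that)
    \<comment> \<open>Vectors on different axes are equal only if both vanish, which would make the
      two pairs equal. The second entry is \<open>b' - b\<close> because its term changes sides in
      the congruence.\<close>
    show "(axis s (a - a') :: int ^ 'n) \<noteq> axis t (b' - b)"
      using assms(2) ab(3) by (auto simp: axis_eq_axis)
    have "int_dot (axis s (a - a') - axis t (b' - b)) z = (a * z $ s + b * z $ t) - (a' * z $ s + b' * z $ t)"
      by (simp add: int_dot_diff dot algebra_simps)
    then show "int M dvd int_dot (axis s (a - a') - axis t (b' - b)) z"
      using ab(4) by (simp add: mod_eq_dvd_iff)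
  qed (use ab bnd in \<open>auto simp: S_def\<close>)
qed

text \<open>On an axis the isotropic and the product factor have the same base, so the quotient of
  source and target weight is the power \<alpha> + \<beta> - \<gamma> of 1 + a^2. This is what makes
  axis frequencies suitable for the lower bound.\<close>

lemma hybrid_weight_axis:
  "hybrid_weight \<alpha> \<beta> (axis s a) = (1 + (real_of_int a)\<^sup>2) powr (\<alpha> + \<beta>)"
proof -
  have "(real_of_int (axis s a $ t))\<^sup>2 = (if t = s then (real_of_int a)\<^sup>2 else 0)" for t
    by (simp add: axis_def)
  moreover from this have "1 + (real_of_int (axis s a $ t))\<^sup>2 = (if t = s then 1 + (real_of_int a)\<^sup>2 else 1)" for t
    by simp
  ultimately show ?thesis
    unfolding hybrid_weight_alt by (simp add: powr_add add.commute)
qed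

lemma exp_diff_in_space:
  assumes "k \<noteq> l"
  shows "exp_diff a k l \<in> cont_hybrid_space \<alpha> \<beta>"
    and "hybrid_norm \<alpha> \<beta> (exp_diff a k l) = ennreal (cmod a * sqrt (hybrid_weight \<alpha> \<beta> k + hybrid_weight \<alpha> \<beta> l))"
proof -
  let ?u = "\<lambda>h. (cmod (fourier_coeff (exp_diff a k l) h))\<^sup>2 * hybrid_weight \<alpha> \<beta> h"
  have cont: "continuous_on UNIV (exp_diff a k l)"
    unfolding exp_diff_def[abs_def] by (rule continuous_trig_sum)
  have per: "periodic (exp_diff a k l)"
    unfolding exp_diff_def[abs_def] by (rule periodic_trig_sum)
  have "(?u has_sum (\<Sum>h\<in>{k, l}. ?u h)) UNIV"
    by (rule has_sum_finite_neutralI) (auto simp: fourier_coeff_exp_diff)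
  also have "(\<Sum>h\<in>{k, l}. ?u h) = (cmod a)\<^sup>2 * (hybrid_weight \<alpha> \<beta> k + hybrid_weight \<alpha> \<beta> l)"
    using assms by (simp add: fourier_coeff_exp_diff ring_distribs)
  finally have hs: "(?u has_sum (cmod a)\<^sup>2 * (hybrid_weight \<alpha> \<beta> k + hybrid_weight \<alpha> \<beta> l)) UNIV" .
  then have sp: "exp_diff a k l \<in> hybrid_space \<alpha> \<beta>"
    by (auto simp: hybrid_space_def L2_torus_continuous[OF per cont] summable_on_def)
  then show "exp_diff a k l \<in> cont_hybrid_space \<alpha> \<beta>" by (simp add: cont_hybrid_space_def cont)
  show "hybrid_norm \<alpha> \<beta> (exp_diff a k l) = ennreal (cmod a * sqrt (hybrid_weight \<alpha> \<beta> k + hybrid_weight \<alpha> \<beta> l))"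
    using sp infsumI[OF hs] by (simp add: hybrid_norm_def real_sqrt_mult)
qed

text \<open>The test function equals its own error, so the quotient of its two norms bounds the
  operator norm from below. The estimate 1 + a^2 \<le> 2 M for a^2 \<le> M is the origin of the
  factor \<open>2 powr ((\<alpha> + \<beta> - \<gamma>) / 2)\<close>. Vanishing at the nodes makes
  the argument work for every \<open>I\<close>.\<close>

lemma sampling_error_lower_bound:
  fixes z :: "int ^ 'n::finite"
  assumes M: "M \<ge> 1" and \<sigma>: "\<alpha> + \<beta> \<ge> \<gamma>" and d: "CARD('n) \<ge> 2"
  shows "ennreal (real M powr (- (\<alpha> + \<beta> - \<gamma>) / 2)) \<le> ennreal (2 powr ((\<alpha> + \<beta> - \<gamma>) / 2)) *
    operator_norm (cont_hybrid_space \<alpha> \<beta>) (hybrid_norm \<alpha> \<beta>) (sobolev_norm \<gamma>)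
      (\<lambda>f x. f x - sampling_op I z M f x)"
proof -
  let ?\<sigma> = "\<alpha> + \<beta> - \<gamma>"
  obtain s t :: 'n where "s \<noteq> t"
    using d by (metis (full_types) UNIV_I card_2_iff' card_le_Suc0_iff_eq finite not_less_eq_eq numeral_2_eq_2)
  then obtain a b where ab: "(axis s a :: int ^ 'n) \<noteq> axis t b" "int M dvd int_dot (axis s a - axis t b) z"
    "a\<^sup>2 \<le> int M" "b\<^sup>2 \<le> int M"
    using axis_alias_pair[OF M] by blast
  define k l :: "int ^ 'n" where "k = axis s a" and "l = axis t b"
  define W where "W = hybrid_weight \<alpha> \<beta> k + hybrid_weight \<alpha> \<beta> l"
  define V where "V = hybrid_weight 0 \<gamma> k + hybrid_weight 0 \<gamma> l"
  have W: "W > 0" by (simp add: W_def add_pos_pos hybrid_weight_pos)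
  have weight_le: "(1 + (real_of_int x)\<^sup>2) powr (\<alpha> + \<beta>) \<le> (2 * real M) powr ?\<sigma> * (1 + (real_of_int x)\<^sup>2) powr \<gamma>"
    if "x\<^sup>2 \<le> int M" for x
  proof -
    have "real_of_int (x\<^sup>2) \<le> real_of_int (int M)" using that by (simp only: of_int_le_iff)
    then have "1 + (real_of_int x)\<^sup>2 \<le> 2 * real M" using M by simp
    then have "(1 + (real_of_int x)\<^sup>2) powr ?\<sigma> \<le> (2 * real M) powr ?\<sigma>"
      using \<sigma> by (intro powr_mono2) auto
    then have "(1 + (real_of_int x)\<^sup>2) powr ?\<sigma> * (1 + (real_of_int x)\<^sup>2) powr \<gamma> \<le> (2 * real M) powr ?\<sigma> * (1 + (real_of_int x)\<^sup>2) powr \<gamma>"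
      by (intro mult_right_mono) auto
    then show ?thesis by (simp flip: powr_add)
  qed
  have WV: "W \<le> (2 * real M) powr ?\<sigma> * V"
    unfolding W_def V_def k_def l_def hybrid_weight_axis ring_distribs
    using weight_le[OF ab(3)] weight_le[OF ab(4)] by simp
  define f where "f = exp_diff (of_real (1 / sqrt W)) k l"
  have kl: "k \<noteq> l" using ab(1) by (simp add: k_def l_def)
  have f: "f \<in> cont_hybrid_space \<alpha> \<beta>" "hybrid_norm \<alpha> \<beta> f \<le> 1"
    unfolding f_def using W by (simp_all add: exp_diff_in_space[OF kl] norm_divide flip: W_def)
  have "sampling_op I z M f = (\<lambda>x. 0)"
    unfolding f_def by (rule sampling_exp_diff[OF M _ kl]) (use ab(2) in \<open>simp add: k_def l_def\<close>)
  then have "sobolev_norm \<gamma> (\<lambda>x. f x - sampling_op I z M f x) = hybrid_norm 0 \<gamma> f"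
    by (simp add: sobolev_norm_def)
  also have "\<dots> = ennreal (sqrt (V / W))"
    unfolding f_def using W by (simp add: exp_diff_in_space(2)[OF kl] norm_divide real_sqrt_divide flip: V_def)
  finally have err: "ennreal (sqrt (V / W)) \<le> operator_norm (cont_hybrid_space \<alpha> \<beta>) (hybrid_norm \<alpha> \<beta>) (sobolev_norm \<gamma>)
      (\<lambda>f x. f x - sampling_op I z M f x)"
    unfolding operator_norm_def using f by (intro SUP_upper2[of f]) auto
  have "real M powr (- ?\<sigma> / 2) \<le> 2 powr (?\<sigma> / 2) * sqrt (V / W)"
  proof -
    have "0 < (2 * real M) powr ?\<sigma>" using M by simp
    with WV W have "1 / (2 * real M) powr ?\<sigma> \<le> V / W"
      by (simp only: divide_le_eq pos_le_divide_eq) (simp add: mult_ac)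
    then have "(2 * real M) powr (- ?\<sigma>) \<le> V / W"
      by (simp only: powr_minus_divide)
    then have "sqrt ((2 * real M) powr (- ?\<sigma>)) \<le> sqrt (V / W)" by (rule real_sqrt_le_mono)
    also have "sqrt ((2 * real M) powr (- ?\<sigma>)) = 2 powr (- ?\<sigma> / 2) * real M powr (- ?\<sigma> / 2)"
      using M by (simp add: powr_half_sqrt[symmetric] powr_powr powr_mult)
    finally have "2 powr (?\<sigma> / 2) * (2 powr (- ?\<sigma> / 2) * real M powr (- ?\<sigma> / 2)) \<le> 2 powr (?\<sigma> / 2) * sqrt (V / W)"
      by (intro mult_left_mono) auto
    moreover have "2 powr (r / 2) * (2 powr (- r / 2) * x) = x" for r x :: real
      by (simp flip: powr_add mult.assoc)
    ultimately show ?thesis by (simp only:)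
  qed
  then have "ennreal (real M powr (- ?\<sigma> / 2)) \<le> ennreal (2 powr (?\<sigma> / 2) * sqrt (V / W))"
    by (rule ennreal_leI)
  also have "\<dots> = ennreal (2 powr (?\<sigma> / 2)) * ennreal (sqrt (V / W))"
    by (rule ennreal_mult') simp
  also have "\<dots> \<le> ennreal (2 powr (?\<sigma> / 2)) * operator_norm (cont_hybrid_space \<alpha> \<beta>) (hybrid_norm \<alpha> \<beta>) (sobolev_norm \<gamma>)
      (\<lambda>f x. f x - sampling_op I z M f x)"
    by (intro mult_left_mono err) auto
  finally show ?thesis .
qed

section \<open>Lattice size and refinement\<close>

lemma reconstructing_lattice_size_ge:
  fixes z :: "int ^ 'n::finite"
  assumes "R \<ge> 1" "reconstructing_lattice (hyperbolic_cross R) z M"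
  shows "2 ^ cross_radius R CARD('n) < M"
proof -
  let ?n = "cross_radius R CARD('n)" and ?s = "undefined :: 'n"
  have M: "M \<ge> 1" using assms(2) by (simp add: reconstructing_lattice_def)
  \<comment> \<open>The nonnegative half of one axis suffices: its \<open>2 ^ ?n + 1\<close>
    frequencies in the cross need distinct residues modulo \<open>M\<close>. The bound serves only
    to compare \<open>R\<close> with \<open>ln M\<close> and to keep \<open>M\<close> away from
    1.\<close>
  have mem: "axis ?s a \<in> hyperbolic_cross R" if "a \<in> {0..2 ^ ?n}" for a :: int
  proof -
    have "lev (axis ?s a $ t) = (if t = ?s then lev a else 0)" for t
      using lev_le[of 0 0] by (simp add: axis_def)
    then have "total_lev (axis ?s a) = lev a" by (simp add: total_lev_def)
    also have "\<dots> \<le> ?n" using that by (intro lev_le) auto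
    finally show ?thesis by (simp add: hyperbolic_cross_iff[OF assms(1)])
  qed
  have "inj_on (\<lambda>a. int_dot (axis ?s a) z mod int M) {0..2 ^ ?n}"
  proof (rule inj_onI)
    fix a b :: int assume ab: "a \<in> {0..2 ^ ?n}" "b \<in> {0..2 ^ ?n}"
      "int_dot (axis ?s a) z mod int M = int_dot (axis ?s b) z mod int M"
    then have "int M dvd int_dot (axis ?s a - axis ?s b) z"
      by (simp add: mod_eq_dvd_iff int_dot_diff)
    from reconstructing_lattice_distinct[OF assms(2) finite_hyperbolic_cross[OF assms(1)] mem[OF ab(1)] mem[OF ab(2)] this]
    show "a = b" by (auto simp: axis_eq_axis)
  qed
  then have "card {0..(2::int) ^ ?n} \<le> card {0..<int M}"
    by (rule card_inj_on_le) (use M in auto)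
  then show ?thesis by (simp add: nat_add_distrib nat_power_eq)
qed

text \<open>The upper bound on \<open>M\<close> replaces \<open>2 powr (- \<sigma> * R)\<close> by
  \<open>M powr (- \<sigma> / 2)\<close> at the cost of \<open>R powr (e * \<sigma> / 2)\<close>;
  the lower bound on \<open>M\<close> then turns every power of \<open>R\<close> into one of
  \<open>ln M\<close>.\<close>

lemma bound_in_terms_of_size:
  fixes \<sigma> K e p :: real
  assumes "K > 0" "\<sigma> \<ge> 0" "e \<ge> 0" "p \<ge> 0" "R \<ge> 1" "M \<ge> 3" "2 powr R \<le> M"
    and M: "M \<le> K * (2 powr (2 * R) * R powr e)"
  shows "2 powr (- \<sigma> * R) * R powr p \<le>
    K powr (\<sigma> / 2) * 2 powr (e * \<sigma> / 2) * 2 powr p * (M powr (- \<sigma> / 2) * ln M powr (e * \<sigma> / 2) * ln M powr p)"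
proof -
  have "ln (2 powr R) \<le> ln M" using assms by (intro ln_mono) auto
  then have "R * ln 2 \<le> ln M" by (simp add: ln_powr)
  \<comment> \<open>This makes the factor in \<open>R \<le> 2 * ln M\<close> explicit, hence the
    powers of 2 in the constant.\<close>
  moreover have "1 / 2 \<le> ln (2::real)" by (subst ln_ge_iff) (use exp_half_le2 in simp_all)
  then have "R * (1 / 2) \<le> R * ln 2" using assms by (intro mult_left_mono) auto
  ultimately have R: "R \<le> 2 * ln M" by linarith
  have "M powr (\<sigma> / 2) \<le> (K * (2 powr (2 * R) * R powr e)) powr (\<sigma> / 2)"
    using assms by (intro powr_mono2) auto
  also have "\<dots> = K powr (\<sigma> / 2) * (2 powr (\<sigma> * R) * R powr (e * \<sigma> / 2))"
    using assms by (simp add: powr_mult powr_powr mult_ac)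
  also have "R powr (e * \<sigma> / 2) \<le> (2 * ln M) powr (e * \<sigma> / 2)"
    using R assms by (intro powr_mono2) auto
  finally have 1: "M powr (\<sigma> / 2) \<le> K powr (\<sigma> / 2) * (2 powr (\<sigma> * R) * (2 * ln M) powr (e * \<sigma> / 2))"
    using assms by (simp add: mult_left_mono)
  have "2 powr (- \<sigma> * R) = 2 powr (- \<sigma> * R) * M powr (- \<sigma> / 2) * M powr (\<sigma> / 2)"
    using assms by (simp add: powr_minus)
  also have "\<dots> \<le> 2 powr (- \<sigma> * R) * M powr (- \<sigma> / 2) * (K powr (\<sigma> / 2) * (2 powr (\<sigma> * R) * (2 * ln M) powr (e * \<sigma> / 2)))"
    by (intro mult_left_mono 1) auto
  also have "\<dots> = (2 powr (- \<sigma> * R) * 2 powr (\<sigma> * R)) * (K powr (\<sigma> / 2) * M powr (- \<sigma> / 2) * (2 * ln M) powr (e * \<sigma> / 2))"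
    by (simp only: mult_ac)
  also have "\<dots> = K powr (\<sigma> / 2) * M powr (- \<sigma> / 2) * (2 * ln M) powr (e * \<sigma> / 2)"
    by (simp flip: powr_add)
  finally have 2: "2 powr (- \<sigma> * R) \<le> K powr (\<sigma> / 2) * M powr (- \<sigma> / 2) * (2 * ln M) powr (e * \<sigma> / 2)" .
  have "R powr p \<le> (2 * ln M) powr p" using R assms by (intro powr_mono2) auto
  with 2 have "2 powr (- \<sigma> * R) * R powr p \<le> K powr (\<sigma> / 2) * M powr (- \<sigma> / 2) * (2 * ln M) powr (e * \<sigma> / 2) * (2 * ln M) powr p"
    by (intro mult_mono) auto
  also have "\<dots> = K powr (\<sigma> / 2) * 2 powr (e * \<sigma> / 2) * 2 powr p * (M powr (- \<sigma> / 2) * ln M powr (e * \<sigma> / 2) * ln M powr p)"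
    using assms by (simp add: powr_mult mult_ac)
  finally show ?thesis .
qed

text \<open>\<open>K\<close> is the constant of the size estimate guaranteed by the search; among
  the three constants constructed in the proof only \<open>c3\<close> involves it.\<close>

theorem proposition4p6:
  fixes \<alpha> \<beta> \<gamma> K :: real
  assumes "\<alpha> > 1/2" and "\<beta> \<le> 0" and "\<gamma> \<ge> 0" and "\<alpha> + \<beta> > max \<gamma> (1/2)"
    and "CARD('n::{finite,linorder}) \<ge> 2"
    and "K > 0"
  shows "\<exists>c1>0. \<exists>c2>0. \<exists>c3>0. \<forall>R\<ge>1. \<forall>(z :: int ^ 'n::{finite,linorder}) M.
    reconstructing_lattice (hyperbolic_cross R) z M \<and>
    cbc_lattice (hyperbolic_cross R) z M \<and>
    real M \<le> K * (2 powr (2 * R) * R powr (real CARD('n) - 2)) \<longrightarrow>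
    (let err = operator_norm (cont_hybrid_space \<alpha> \<beta>) (hybrid_norm \<alpha> \<beta>) (sobolev_norm \<gamma>)
                 (\<lambda>f x. f x - sampling_op (hyperbolic_cross R) z M f x);
         bound = 2 powr (- (\<alpha> + \<beta> - \<gamma>) * R) *
                   (if \<beta> = 0 then R powr ((real CARD('n) - 1) / 2) else 1)
     in ennreal (real M powr (- (\<alpha> + \<beta> - \<gamma>) / 2)) \<le> ennreal c1 * err \<and>
        err \<le> ennreal (c2 * bound) \<and>
        bound \<le> c3 * (real M powr (- (\<alpha> + \<beta> - \<gamma>) / 2) *
                   ln (real M) powr ((real CARD('n) - 2) * (\<alpha> + \<beta> - \<gamma>) / 2) *
                   (if \<beta> = 0 then ln (real M) powr ((real CARD('n) - 1) / 2) else 1)))"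
proof -
  define \<sigma> where "\<sigma> = \<alpha> + \<beta> - \<gamma>"
  define d where "d = real CARD('n)"
  \<comment> \<open>With exponent 0 for \<open>\<beta> < 0\<close>, both cases become a single power
    \<open>powr p\<close>.\<close>
  define p where "p = (if \<beta> = 0 then (d - 1) / 2 else 0)"
  have less: "\<alpha> + \<beta> > \<gamma>" "\<alpha> + \<beta> > 1/2" and d: "d \<ge> 2"
    using assms(4,5) by (auto simp: d_def)
  obtain c where c: "c > 0" "\<And>R (z :: int ^ 'n::{finite,linorder}) M f. R \<ge> 1 \<Longrightarrow> reconstructing_lattice (hyperbolic_cross R) z M \<Longrightarrow>
    f \<in> cont_hybrid_space \<alpha> \<beta> \<Longrightarrow> hybrid_norm \<alpha> \<beta> f \<le> 1 \<Longrightarrow>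
    sobolev_norm \<gamma> (\<lambda>x. f x - sampling_op (hyperbolic_cross R) z M f x)
      \<le> ennreal (c * (2 powr (- \<sigma> * R) * (if \<beta> = 0 then R powr ((d - 1) / 2) else 1)))"
    using sampling_error_upper_bound[OF assms(2,3) less assms(5)] unfolding d_def \<sigma>_def by blast
  define c3 where "c3 = K powr (\<sigma> / 2) * 2 powr ((d - 2) * \<sigma> / 2) * 2 powr p"
  have "ennreal (real M powr (- \<sigma> / 2)) \<le> ennreal (2 powr (\<sigma> / 2)) * err \<and> err \<le> ennreal (c * bound) \<and>
      bound \<le> c3 * (real M powr (- \<sigma> / 2) * ln (real M) powr ((d - 2) * \<sigma> / 2) *
        (if \<beta> = 0 then ln (real M) powr ((d - 1) / 2) else 1))"
    if R: "R \<ge> 1" and rec: "reconstructing_lattice (hyperbolic_cross R) z M"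
      and M: "real M \<le> K * (2 powr (2 * R) * R powr (d - 2))"
      and err: "err = operator_norm (cont_hybrid_space \<alpha> \<beta>) (hybrid_norm \<alpha> \<beta>) (sobolev_norm \<gamma>)
                 (\<lambda>f x. f x - sampling_op (hyperbolic_cross R) z M f x)"
      and bound: "bound = 2 powr (- \<sigma> * R) * (if \<beta> = 0 then R powr ((d - 1) / 2) else 1)"
    for R and z :: "int ^ 'n::{finite,linorder}" and M err bound
  proof (intro conjI)
    have M1: "M \<ge> 1" using rec by (simp add: reconstructing_lattice_def)
    show "ennreal (real M powr (- \<sigma> / 2)) \<le> ennreal (2 powr (\<sigma> / 2)) * err"
      unfolding err \<sigma>_def using less by (intro sampling_error_lower_bound M1 assms(5)) simp
    show "err \<le> ennreal (c * bound)"
      unfolding err bound operator_norm_def by (intro SUP_least c(2)[OF R rec]) auto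
    \<comment> \<open>The lower bound on the size is strict, so
      \<open>2 powr R \<le> real M - 1\<close> and \<open>M \<ge> 3\<close>. Then
      \<open>ln M\<close> is nonzero, and \<open>ln M powr 0\<close> is indeed 1 in the case
      \<open>\<beta> < 0\<close>.\<close>
    have "R \<le> real (cross_radius R CARD('n))" using cross_radius_ge(1)[OF R assms(5)] .
    then have "2 powr R \<le> 2 powr real (cross_radius R CARD('n))" by (rule powr_mono) simp
    also have "\<dots> = real (2 ^ cross_radius R CARD('n))" by (simp add: powr_realpow)
    also have "\<dots> \<le> real M - 1" using reconstructing_lattice_size_ge[OF R rec] by linarith
    finally have "2 powr R \<le> real M - 1" .
    moreover have "2 powr 1 \<le> 2 powr R" using R by (intro powr_mono) auto
    ultimately have M3: "real M \<ge> 3" "2 powr R \<le> real M" by auto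
    have "bound = 2 powr (- \<sigma> * R) * R powr p"
      using R by (auto simp: bound p_def)
    also have "\<dots> \<le> c3 * (real M powr (- \<sigma> / 2) * ln (real M) powr ((d - 2) * \<sigma> / 2) * ln (real M) powr p)"
      unfolding c3_def
      by (rule bound_in_terms_of_size[OF assms(6) _ _ _ R M3 M]) (use less d in \<open>auto simp: \<sigma>_def p_def\<close>)
    also have "ln (real M) powr p = (if \<beta> = 0 then ln (real M) powr ((d - 1) / 2) else 1)"
      using M3 by (auto simp: p_def)
    finally show "bound \<le> c3 * (real M powr (- \<sigma> / 2) * ln (real M) powr ((d - 2) * \<sigma> / 2) *
        (if \<beta> = 0 then ln (real M) powr ((d - 1) / 2) else 1))" .
  qed
  moreover have "c3 > 0" using assms(6) by (simp add: c3_def)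
  ultimately show ?thesis
    using c(1) unfolding Let_def \<sigma>_def d_def
    by (intro exI[of _ "2 powr ((\<alpha> + \<beta> - \<gamma>) / 2)"] exI[of _ c] exI[of _ c3] conjI allI impI) auto
qed

end
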